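(* Let $p\in\mathbb{N}_0$ and $m:=\lceil p/2\rceil$. Then the space $\mathcal{X}_h:=\hat{\mathscr{N}}^p(\check{\mathcal{K}}_h,\mathcal{W}_h)$ of transformed NURBS is a subspace of $L^2(\Gamma)$ which satisfies, with this $m$, the following assumptions: (A1) For each $T\in\mathcal{T}_h$ there exists some fixed function $\psi_T\in\mathcal{X}_h$ with connected support $\mathrm{supp}(\psi_T)$ such that $T\subseteq\mathrm{supp}(\psi_T)\subseteq\omega_h^m(T)$. (A2) $\|1-\psi_T\|_{L^2(\mathrm{supp}(\psi_T))}^2\le(1-q)\,|\mathrm{supp}(\psi_T)|$ for all $T\in\mathcal{T}_h$, where $$q=q\big(\kappa(\check{\mathcal{T}}_h),\min(\mathcal{W}_h),\max(\mathcal{W}_h),p,\varphi\big)\in(0,1]$$ is the NURBS constant defined in the context for $\varphi=|\gamma'|\,|_I$, with $I=[a-(b-a)(m+p),\,b+(b-a)(2p-m)]$ if $\Gamma$ is closed and $I=[a,b]$ if $\Gamma$ is open.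
   Context: **Boundary.** $\Omega\subset\mathbb{R}^2$ is a Lipschitz domain and $\Gamma\subseteq\partial\Omega$ is a compact, connected, piecewise smooth part of its boundary. Either $\Gamma=\partial\Omega$ ("closed $\Gamma$") is parametrized by a closed, continuous, piecewise two times continuously differentiable path $\gamma:[a,b]\to\Gamma$ such that $\gamma|_{[a,b)}$ is bijective (its $(b-a)$-periodic extension to $\mathbb{R}$ is also denoted by $\gamma$), or $\Gamma\subsetneqq\partial\Omega$ ("open $\Gamma$") is parametrized by a bijective, continuous, piecewise two times continuously differentiable path $\gamma:[a,b]\to\Gamma$. The left derivative satisfies $\gamma^{\prime_\ell}(t)\neq0$ for $t\in(a,b]$, the right derivative satisfies $\gamma^{\prime_r}(t)\neq0$ for $t\in[a,b)$, and $\gamma^{\prime_\ell}(t)+c\,\gamma^{\prime_r}(t)\neq0$ for all $c>0$ and all $t\in[a,b]$ (closed $\Gamma$) resp. $t\in(a,b)$ (open $\Gamma$). Integrals over subsets of $\Gamma$ are with respect to arclength, and $|\cdot|$ of a curve is its arclength. At the finitely many break points, $\gamma'$ may be taken as any existing one-sided derivative. **Mesh.** $\mathcal{T}_h=\{T_1,\dots,T_n\}$ is a partition of $\Gamma$ into compact connected segments $T_j=\gamma(\check T_j)$, $\check T_j=[\check z_{j-1},\check z_j]$, with $a=\check z_0<\check z_1<\dots<\check z_n=b$; $\check{\mathcal{T}}_h=\{\check T_1,\dots,\check T_n\}$; $z_j=\gamma(\check z_j)$. The parameter nodes are $\check{\mathcal{N}}_h=\{\check z_1,\dots,\check z_n\}$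 for closed $\Gamma$ and $\check{\mathcal{N}}_h=\{\check z_0,\dots,\check z_n\}$ for open $\Gamma$. For closed $\Gamma$ it is assumed that every $T\in\mathcal{T}_h$ has arclength at most $|\Gamma|/4$. With $h_{\check T}$ the length of $\check T$, $\kappa(\check{\mathcal{T}}_h):=\max\{h_{\check T}/h_{\check T'}:\check T,\check T'\in\check{\mathcal{T}}_h,\ \gamma(\check T)\cap\gamma(\check T')\neq\emptyset\}$. For $T\in\mathcal{T}_h$, $\omega_h^0(T):=T$ and $\omega_h^{k+1}(T):=\bigcup\{T'\in\mathcal{T}_h:T'\cap\omega_h^k(T)\neq\emptyset\}$. **B-splines and NURBS.** For knots $\check{\mathcal{K}}=(t_i)_{i\in\mathbb{Z}}$ in $\mathbb{R}$ with $t_{i-1}\le t_i$ and $\lim_{i\to\pm\infty}t_i=\pm\infty$, let $B_{i,0}:=\chi_{[t_{i-1},t_i)}$ and $B_{i,p}:=\beta_{i-1,p}B_{i,p-1}+(1-\beta_{i,p})B_{i+1,p-1}$ for $p\in\mathbb{N}$, where $\beta_{i,p}(t):=\frac{t-t_i}{t_{i+p}-t_i}$ if $t_i\neq t_{i+p}$ and $\beta_{i,p}(t):=0$ otherwise. For weights $\mathcal{W}=(w_i)_{i\in\mathbb{Z}}$, $w_i>0$, let $R_{i,p}:=\frac{w_iB_{i,p}}{\sum_{\ell\in\mathbb{Z}}w_\ell B_{\ell,p}}$ and $\mathscr{N}^p(\check{\mathcal{K}},\mathcal{W}):=\{\sum_{i\in\mathbb{Z}}a_iR_{i,p}:a_i\in\mathbb{R}\}$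 (locally finite sums). $R_{i,p}$ is completely determined by the knots $t_{i-p-1},\dots,t_{i+2p}$ and the weights $w_{i-p},\dots,w_{i+p}$, and one writes $R(\cdot|t_{i-p-1},\dots,t_{i+2p},w_{i-p},\dots,w_{i+p}):=R_{i,p}$. **The space $\hat{\mathscr{N}}^p(\check{\mathcal{K}}_h,\mathcal{W}_h)$.** Closed $\Gamma$: each node $\check z\in\check{\mathcal{N}}_h$ is assigned a multiplicity $\#\check z\in\{1,\dots,p+1\}$, which induces a non-decreasing knot sequence $\check{\mathcal{K}}_h=(t_i)_{i=1}^N$ on $(a,b]$; $\mathcal{W}_h=(w_i)_{i=1}^N$ are positive weights. Knots are extended $(b-a)$-periodically to $(t_i)_{i\in\mathbb{Z}}$ and weights by $w_{N+i}:=w_i$ for $i\in\mathbb{Z}$, and $\hat{\mathscr{N}}^p(\check{\mathcal{K}}_h,\mathcal{W}_h):=\{g|_{[a,b)}\circ\gamma|_{[a,b)}^{-1}:g\in\mathscr{N}^p(\check{\mathcal{K}}_h,\mathcal{W}_h)\}$. Open $\Gamma$: each node is assigned a multiplicity $\#\check z\in\{1,\dots,p+1\}$ with $\#\check z_0=\#\check z_n=p+1$, which induces a non-decreasing knot sequence $\check{\mathcal{K}}_h=(t_i)_{i=0}^N$ on $[a,b]$; $\mathcal{W}_h=(w_i)_{i=1}^{N-p}$ are positive weights. The sequences are extended arbitrarily to non-decreasing $(t_i)_{i\in\mathbb{Z}}$ with $a>t_i\to-\infty$ for $i<0$ and $b<t_i\to\infty$ for $i>N$, and $(w_i)_{i\in\mathbb{Z}}$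 with $w_i>0$, and $\hat{\mathscr{N}}^p(\check{\mathcal{K}}_h,\mathcal{W}_h):=\{g|_{[a,b]}\circ\gamma^{-1}:g\in\mathscr{N}^p(\check{\mathcal{K}}_h,\mathcal{W}_h)\}$ (as a subset of $L^2(\Gamma)$ independent of the extension). $\min(\mathcal{W}_h)$ and $\max(\mathcal{W}_h)$ are the minimum and maximum of the given finitely many weights. **NURBS constant.** For a compact interval $I$ with nonempty interior, $\kappa_{\max}\ge1$, $0<w_{\min}\le w_{\max}$, $p\in\mathbb{N}_0$, and a piecewise continuously differentiable $\varphi:I\to(0,\infty)$ with positive infimum, $q(\kappa_{\max},w_{\min},w_{\max},p,\varphi)\in(0,1]$ denotes a constant (such a constant exists) with the following property: for all knots $t_0\le\dots\le t_{3p+1}$ in $I$ whose distinct values $\check z_0<\dots<\check z_\nu$ satisfy $\frac{\check z_{j+1}-\check z_j}{\check z_j-\check z_{j-1}}\le\kappa_{\max}$ and $\frac{\check z_j-\check z_{j-1}}{\check z_{j+1}-\check z_j}\le\kappa_{\max}$ for $j=1,\dots,\nu-1$, all weights $w_1,\dots,w_{2p+1}\in[w_{\min},w_{\max}]$, and all $\ell\in\{p+1,\dots,2p+1\}$, $$\big\|\big(1-R(\cdot|t_0,\dots,t_{3p+1},w_1,\dots,w_{2p+1})\big)\varphi\big\|_{L^1([t_{\ell-1},t_\ell])}\le(1-q)\,\|\varphi\|_{L^1([t_{\ell-1},t_\ell])}.$$ *)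

theory Defs
  imports "HOL-Analysis.Analysis" "HOL-Library.Function_Algebras"
begin

section \<open>The boundary part and its parametrization\<close>

text \<open>A (not necessarily bounded) domain in the plane which near every boundary point is, in suitable
  orthonormal coordinates, the strict hypograph of a Lipschitz function.\<close>

definition lipschitz_domain :: "(real^2) set \<Rightarrow> bool" where
  "lipschitz_domain \<Omega> \<longleftrightarrow> open \<Omega> \<and> connected \<Omega> \<and> \<Omega> \<noteq> {} \<and>
     (\<forall>x\<in>frontier \<Omega>. \<exists>U e1 e2 (g :: real \<Rightarrow> real) L.
        open U \<and> x \<in> U \<and> norm e1 = 1 \<and> norm e2 = 1 \<and> e1 \<bullet> e2 = 0 \<and>
        L-lipschitz_on UNIV g \<and> \<Omega> \<inter> U = {y\<in>U. y \<bullet> e2 < g (y \<bullet> e1)})"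

text \<open>Twice continuously differentiable on each closed piece of a finite subdivision, with
  one-sided derivatives at the end points of the pieces. The functions \<open>\<gamma>1\<close>, \<open>\<gamma>2\<close> may depend on
  the piece. The library's piecewise \<open>C1\<close> notion imposes no condition on the derivative near the
  break points and is therefore not used.\<close>

definition piecewise_C2_path :: "real \<Rightarrow> real \<Rightarrow> (real \<Rightarrow> real^2) \<Rightarrow> bool" where
  "piecewise_C2_path a b \<gamma> \<longleftrightarrow> continuous_on {a..b} \<gamma> \<and>
     (\<exists>S. finite S \<and> {a, b} \<subseteq> S \<and> S \<subseteq> {a..b} \<and>
        (\<forall>c\<in>S. \<forall>d\<in>S. c < d \<and> S \<inter> {c<..<d} = {} \<longrightarrow>
           (\<exists>\<gamma>1 \<gamma>2. (\<forall>s\<in>{c..d}. (\<gamma> has_vector_derivative \<gamma>1 s) (at s within {c..d})) \<and>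
                    (\<forall>s\<in>{c..d}. (\<gamma>1 has_vector_derivative \<gamma>2 s) (at s within {c..d})) \<and>
                    continuous_on {c..d} \<gamma>2)))"

definition left_deriv :: "(real \<Rightarrow> real^2) \<Rightarrow> real \<Rightarrow> real^2" where
  "left_deriv \<gamma> s = vector_derivative \<gamma> (at_left s)"

definition right_deriv :: "(real \<Rightarrow> real^2) \<Rightarrow> real \<Rightarrow> real^2" where
  "right_deriv \<gamma> s = vector_derivative \<gamma> (at_right s)"

text \<open>The flag \<open>cl\<close> distinguishes closed \<open>\<Gamma>\<close> (\<open>True\<close>) from open \<open>\<Gamma>\<close> (\<open>False\<close>) throughout. For closed
  \<open>\<Gamma>\<close>, \<open>\<gamma>\<close> is already the \<open>(b - a)\<close>-periodic extension; for open \<open>\<Gamma>\<close>, the values of \<open>\<gamma>\<close> outside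
  \<open>[a, b]\<close> are irrelevant.\<close>

definition boundary_part ::
    "bool \<Rightarrow> (real^2) set \<Rightarrow> (real^2) set \<Rightarrow> real \<Rightarrow> real \<Rightarrow> (real \<Rightarrow> real^2) \<Rightarrow> bool" where
  "boundary_part cl \<Omega> \<Gamma> a b \<gamma> \<longleftrightarrow>
     lipschitz_domain \<Omega> \<and> compact \<Gamma> \<and> connected \<Gamma> \<and> a < b \<and> \<gamma> ` {a..b} = \<Gamma> \<and>
     piecewise_C2_path a b \<gamma> \<and>
     (if cl then \<Gamma> = frontier \<Omega> \<and> bij_betw \<gamma> {a..<b} \<Gamma> \<and> (\<forall>s. \<gamma> (s + (b - a)) = \<gamma> s)
      else \<Gamma> \<subset> frontier \<Omega> \<and> bij_betw \<gamma> {a..b} \<Gamma>) \<and>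
     (\<forall>s\<in>{a<..b}. left_deriv \<gamma> s \<noteq> 0) \<and>
     (\<forall>s\<in>{a..<b}. right_deriv \<gamma> s \<noteq> 0) \<and>
     (\<forall>s\<in>(if cl then {a..b} else {a<..<b}). \<forall>c>0. left_deriv \<gamma> s + c *\<^sub>R right_deriv \<gamma> s \<noteq> 0)"

text \<open>\<open>|\<gamma>'|\<close>, with the right derivative at the break points (and the left derivative at \<open>b\<close> if
  \<open>\<Gamma>\<close> is open).\<close>

definition speed :: "bool \<Rightarrow> real \<Rightarrow> (real \<Rightarrow> real^2) \<Rightarrow> real \<Rightarrow> real" where
  "speed cl b \<gamma> s = (if \<not> cl \<and> s = b then norm (left_deriv \<gamma> s) else norm (right_deriv \<gamma> s))"

text \<open>Arclength on \<open>\<Gamma>\<close>: the image under \<open>\<gamma>\<close> of \<open>|\<gamma>'(s)| ds\<close> on \<open>[a, b]\<close>.\<close>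

definition arclength :: "bool \<Rightarrow> real \<Rightarrow> real \<Rightarrow> (real \<Rightarrow> real^2) \<Rightarrow> (real^2) measure" where
  "arclength cl a b \<gamma> =
     distr (density (restrict_space lborel {a..b}) (\<lambda>s. ennreal (speed cl b \<gamma> s)))
           (restrict_space borel (\<gamma> ` {a..b})) \<gamma>"

definition L2_functions :: "'a measure \<Rightarrow> ('a \<Rightarrow> real) set" where
  "L2_functions M = {f \<in> borel_measurable M. integrable M (\<lambda>x. (f x)\<^sup>2)}"

definition supp_on :: "(real^2) set \<Rightarrow> (real^2 \<Rightarrow> real) \<Rightarrow> (real^2) set" where
  "supp_on \<Gamma> f = closure {x\<in>\<Gamma>. f x \<noteq> 0}"


section \<open>Meshes\<close>

definition param_mesh :: "nat \<Rightarrow> (nat \<Rightarrow> real) \<Rightarrow> real set set" where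
  "param_mesh n z = (\<lambda>j. {z (j - 1)..z j}) ` {1..n}"

definition mesh :: "(real \<Rightarrow> real^2) \<Rightarrow> nat \<Rightarrow> (nat \<Rightarrow> real) \<Rightarrow> (real^2) set set" where
  "mesh \<gamma> n z = (\<lambda>P. \<gamma> ` P) ` param_mesh n z"

definition nodes :: "bool \<Rightarrow> nat \<Rightarrow> (nat \<Rightarrow> real) \<Rightarrow> real set" where
  "nodes cl n z = z ` (if cl then {1..n} else {0..n})"

definition is_mesh :: "bool \<Rightarrow> real \<Rightarrow> real \<Rightarrow> (real \<Rightarrow> real^2) \<Rightarrow> nat \<Rightarrow> (nat \<Rightarrow> real) \<Rightarrow> bool" where
  "is_mesh cl a b \<gamma> n z \<longleftrightarrow>
     z 0 = a \<and> z n = b \<and> strict_mono_on {0..n} z \<and>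
     (cl \<longrightarrow> (\<forall>T\<in>mesh \<gamma> n z.
        measure (arclength cl a b \<gamma>) T \<le> measure (arclength cl a b \<gamma>) (\<gamma> ` {a..b}) / 4))"

definition mesh_ratio :: "(real \<Rightarrow> real^2) \<Rightarrow> real set set \<Rightarrow> real" where
  "mesh_ratio \<gamma> P = Max {measure lborel S / measure lborel S' | S S'.
                            S \<in> P \<and> S' \<in> P \<and> \<gamma> ` S \<inter> \<gamma> ` S' \<noteq> {}}"

primrec patch :: "'a set set \<Rightarrow> nat \<Rightarrow> 'a set \<Rightarrow> 'a set" where
  "patch M 0 T = T"
| "patch M (Suc k) T = \<Union>{T'\<in>M. T' \<inter> patch M k T \<noteq> {}}"


section \<open>B-splines and NURBS\<close>

definition knot_sequence :: "(int \<Rightarrow> real) \<Rightarrow> bool" where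
  "knot_sequence t \<longleftrightarrow> mono t \<and> filterlim t at_top at_top \<and> filterlim t at_bot at_bot"

definition bspline_beta :: "(int \<Rightarrow> real) \<Rightarrow> nat \<Rightarrow> int \<Rightarrow> real \<Rightarrow> real" where
  "bspline_beta t p i x =
     (if t i \<noteq> t (i + int p) then (x - t i) / (t (i + int p) - t i) else 0)"

primrec bspline :: "(int \<Rightarrow> real) \<Rightarrow> nat \<Rightarrow> int \<Rightarrow> real \<Rightarrow> real" where
  "bspline t 0 i x = indicator {t (i - 1)..<t i} x"
| "bspline t (Suc p) i x =
     bspline_beta t (Suc p) (i - 1) x * bspline t p i x +
     (1 - bspline_beta t (Suc p) i x) * bspline t p (i + 1) x"

text \<open>For every fixed argument, only finitely many terms of the following sums over all integers
  are nonzero.\<close>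

definition nurbs :: "(int \<Rightarrow> real) \<Rightarrow> (int \<Rightarrow> real) \<Rightarrow> nat \<Rightarrow> int \<Rightarrow> real \<Rightarrow> real" where
  "nurbs t w p i x = w i * bspline t p i x / infsum (\<lambda>l. w l * bspline t p l x) UNIV"

definition nurbs_space :: "(int \<Rightarrow> real) \<Rightarrow> (int \<Rightarrow> real) \<Rightarrow> nat \<Rightarrow> (real \<Rightarrow> real) set" where
  "nurbs_space t w p = {g. \<exists>c. g = (\<lambda>x. infsum (\<lambda>i. c i * nurbs t w p i x) UNIV)}"

text \<open>Knots and weights on the mesh, together with their extension to all integers: periodic for
  closed \<open>\<Gamma>\<close>, arbitrary for open \<open>\<Gamma>\<close>. The function \<open>mlt\<close> gives the multiplicities of the nodes.\<close>

definition mesh_knots ::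
    "bool \<Rightarrow> real \<Rightarrow> real \<Rightarrow> nat \<Rightarrow> (nat \<Rightarrow> real) \<Rightarrow> nat \<Rightarrow> (real \<Rightarrow> nat) \<Rightarrow> nat \<Rightarrow> (int \<Rightarrow> real) \<Rightarrow> bool"
where
  "mesh_knots cl a b n z p mlt N t \<longleftrightarrow>
     knot_sequence t \<and>
     (\<forall>x\<in>nodes cl n z. mlt x \<in> {1..p + 1}) \<and>
     (\<forall>i\<in>{(if cl then 1 else 0)..int N}. t i \<in> nodes cl n z) \<and>
     (\<forall>x\<in>nodes cl n z. card {i\<in>{(if cl then 1 else 0)..int N}. t i = x} = mlt x) \<and>
     (if cl then \<forall>i. t (i + int N) = t i + (b - a)
      else mlt (z 0) = p + 1 \<and> mlt (z n) = p + 1 \<and>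
           (\<forall>i<0. t i < a) \<and> (\<forall>i>int N. b < t i))"

definition mesh_weights :: "bool \<Rightarrow> nat \<Rightarrow> (int \<Rightarrow> real) \<Rightarrow> bool" where
  "mesh_weights cl N w \<longleftrightarrow> (\<forall>i. 0 < w i) \<and> (cl \<longrightarrow> (\<forall>i. w (int N + i) = w i))"

text \<open>The finitely many weights that are actually given, before extension.\<close>

definition given_weights :: "bool \<Rightarrow> nat \<Rightarrow> nat \<Rightarrow> (int \<Rightarrow> real) \<Rightarrow> real set" where
  "given_weights cl p N w = w ` {1..(if cl then int N else int N - int p)}"

text \<open>Transformed NURBS, as functions on \<open>\<Gamma>\<close> (extended by zero to the plane).\<close>

definition transformed_nurbs ::
    "bool \<Rightarrow> real \<Rightarrow> real \<Rightarrow> (real \<Rightarrow> real^2) \<Rightarrow> (int \<Rightarrow> real) \<Rightarrow> (int \<Rightarrow> real) \<Rightarrow> nat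
      \<Rightarrow> (real^2 \<Rightarrow> real) set" where
  "transformed_nurbs cl a b \<gamma> t w p =
     (let D = (if cl then {a..<b} else {a..b}) in
      (\<lambda>g x. if x \<in> \<gamma> ` D then g (inv_into D \<gamma> x) else 0) ` nurbs_space t w p)"


section \<open>The NURBS constant\<close>

text \<open>\<open>q\<close> is an admissible value of \<open>q(\<kappa>, wmin, wmax, p, \<phi>)\<close> for \<open>\<phi> : I \<rightarrow> (0, \<infinity>)\<close>. The function
  \<open>R(\<cdot>|t\<^sub>0,\<dots>,w\<^bsub>2p+1\<^esub>)\<close> is the basis function with index \<open>p + 1\<close>; as it depends only on the listed knots
  and weights, these are presented as part of bi-infinite sequences. The condition on \<open>x, y, v\<close>
  ranges over triples of consecutive distinct knot values.\<close>

definition nurbs_constant ::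
    "real \<Rightarrow> real \<Rightarrow> real \<Rightarrow> nat \<Rightarrow> real set \<Rightarrow> (real \<Rightarrow> real) \<Rightarrow> real \<Rightarrow> bool" where
  "nurbs_constant \<kappa> wmin wmax p I \<phi> q \<longleftrightarrow> 0 < q \<and> q \<le> 1 \<and>
     (\<forall>t w. knot_sequence t \<and> (\<forall>i. 0 < w i) \<and>
        t ` {0..3 * int p + 1} \<subseteq> I \<and>
        w ` {1..2 * int p + 1} \<subseteq> {wmin..wmax} \<and>
        (\<forall>x\<in>t ` {0..3 * int p + 1}. \<forall>y\<in>t ` {0..3 * int p + 1}. \<forall>v\<in>t ` {0..3 * int p + 1}.
           x < y \<and> y < v \<and> t ` {0..3 * int p + 1} \<inter> {x<..<v} = {y} \<longrightarrow>
           (v - y) / (y - x) \<le> \<kappa> \<and> (y - x) / (v - y) \<le> \<kappa>) \<longrightarrow>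
        (\<forall>l\<in>{int p + 1..2 * int p + 1}.
           (LINT x:{t (l - 1)..t l}|lborel. \<bar>(1 - nurbs t w p (int p + 1) x) * \<phi> x\<bar>)
             \<le> (1 - q) * (LINT x:{t (l - 1)..t l}|lborel. \<bar>\<phi> x\<bar>)))"

definition nurbs_interval :: "bool \<Rightarrow> real \<Rightarrow> real \<Rightarrow> nat \<Rightarrow> nat \<Rightarrow> real set" where
  "nurbs_interval cl a b p m =
     (if cl then {a - (b - a) * (real m + real p)..b + (b - a) * (2 * real p - real m)}
      else {a..b})"

end

theory Submission
  imports Defs
begin

text \<open>
  For an element \<open>T\<close>, choose an index \<open>l\<close> whose knot interval \<open>[t\<^bsub>l-1\<^esub>, t\<^sub>l]\<close> is the parameter interval of
  \<open>T\<close>, and put \<open>i = l - m\<close>. The basis function \<open>R\<^sub>i\<close> lives on \<open>[t\<^bsub>i-1\<^esub>, t\<^bsub>i+p\<^esub>]\<close>, an interval that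
  extends \<open>T\<close> by \<open>m\<close> knot intervals to the left and by \<open>p - m \<le> m\<close> to the right. As a knot interval
  is either a point or an element, its image lies in the patch of order \<open>m\<close> (\<open>patch_knots\<close>).
  For open \<open>\<Gamma>\<close> the function \<open>\<psi>\<close> is \<open>R\<^sub>i\<close> itself. For closed \<open>\<Gamma>\<close> it is the sum of all \<open>R\<^sub>k\<close> with
  \<open>k\<close> congruent to \<open>i\<close> modulo \<open>N\<close>: this sum is periodic, hence a function on the closed curve. The two
  cases are treated together through sums \<open>G\<close> of the \<open>R\<^sub>k\<close> over a set of indices containing \<open>i\<close>
  (\<open>nurbs_part\<close>). Since the NURBS are nonnegative and add up to one, \<open>R\<^sub>i \<le> G \<le> 1\<close>.

  B-splines are positive inside every knot interval of their support, so the support of \<open>\<psi>\<close> is exactly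
  the image \<open>Z\<close> of \<open>[t\<^bsub>i-1\<^esub>, t\<^bsub>i+p\<^esub>]\<close>, even if this interval winds around a closed curve more than
  once (\<open>supp_on_eq_image\<close>). As the image of an interval it is connected.

  For the \<open>L\<^sup>2\<close> estimate, \<open>(1 - \<psi>)\<^sup>2 \<le> 1 - \<psi> \<le> 1 - R\<^sub>i\<close>, and the constant \<open>q\<close> controls the integral of
  \<open>(1 - R\<^sub>i) |\<gamma>'|\<close> over each single knot interval in the support of \<open>R\<^sub>i\<close>. It remains to cut \<open>[a, b]\<close> into
  its \<open>N\<close> knot intervals: the image of such an interval either misses \<open>Z\<close> up to end points, or the
  interval is a translate, by a multiple of the period, of a knot interval in the support of \<open>R\<^sub>i\<close>
  (\<open>arclength_defect_le\<close>). This includes supports that wrap around the curve and overlap with their own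
  translates.

  The constant \<open>q\<close> refers to knots in \<open>[a, b]\<close> and to weights in the given range when \<open>\<Gamma>\<close> is open, but
  \<open>R\<^sub>i\<close> formally involves knots and weights of the arbitrary extension. On \<open>[a, b]\<close> the function
  \<open>R\<^sub>i\<close> does not change if these are replaced by suitable ones (\<open>nurbs_clamped\<close>).
\<close>

section \<open>B-splines\<close>

lemma knot_span:
  assumes "knot_sequence t"
  obtains s where "t (s - 1) \<le> x" "x < t s"
proof -
  from assms have top: "filterlim t at_top at_top" and bot: "filterlim t at_bot at_bot"
    and mono: "mono t"
    by (auto simp: knot_sequence_def)
  obtain u where u: "x < t u"
    using top by (metis eventually_at_top_linorder filterlim_at_top_dense order_refl)
  obtain v where v: "t v < x"
    using bot by (metis eventually_at_bot_linorder filterlim_at_bot_dense order_refl)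
  \<comment> \<open>The least index whose knot exceeds \<open>x\<close> is sought above an index \<open>v\<close> with \<open>t\<^sub>v < x\<close>, so that
    natural numbers suffice.\<close>
  let ?P = "\<lambda>k::nat. x < t (v + int k)"
  have "v < u"
    using u v mono by (meson monoD not_le order.strict_trans order.strict_trans2)
  then have "?P (nat (u - v))"
    using u by simp
  then have least: "?P (LEAST k. ?P k)" and below: "\<And>k. k < (LEAST k. ?P k) \<Longrightarrow> \<not> ?P k"
    by (rule LeastI) (rule not_less_Least)
  have pos: "(LEAST k. ?P k) \<noteq> 0"
    using least v by (intro notI) simp
  then have "\<not> ?P ((LEAST k. ?P k) - 1)"
    by (intro below) simp
  with pos least show ?thesis
    by (intro that[of "v + int (LEAST k. ?P k)"]) (auto simp: of_nat_diff algebra_simps not_less)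
qed

lemma knot_sequence_shift:
  assumes "knot_sequence t"
  shows "knot_sequence (\<lambda>k. t (k + d))"
proof -
  have t: "mono t" "filterlim t at_top at_top" "filterlim t at_bot at_bot"
    using assms by (auto simp: knot_sequence_def)
  have "filterlim (\<lambda>k. t (k + d)) at_top at_top"
    unfolding filterlim_at_top
  proof
    fix Z
    obtain K where "\<And>k. K \<le> k \<Longrightarrow> Z \<le> t k"
      using t(2) unfolding filterlim_at_top eventually_at_top_linorder by blast
    then show "eventually (\<lambda>k. Z \<le> t (k + d)) at_top"
      unfolding eventually_at_top_linorder by (intro exI[of _ "K - d"]) simp
  qed
  moreover have "filterlim (\<lambda>k. t (k + d)) at_bot at_bot"
    unfolding filterlim_at_bot
  proof
    fix Z
    obtain K where "\<And>k. k \<le> K \<Longrightarrow> t k \<le> Z"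
      using t(3) unfolding filterlim_at_bot eventually_at_bot_linorder by blast
    then show "eventually (\<lambda>k. t (k + d) \<le> Z) at_bot"
      unfolding eventually_at_bot_linorder by (intro exI[of _ "K - d"]) simp
  qed
  ultimately show ?thesis
    using t(1) by (auto simp: knot_sequence_def mono_def)
qed

lemma mono_index_less:
  fixes t :: "int \<Rightarrow> real"
  assumes "mono t" "t i < t j"
  shows "i < j"
  using assms by (meson monoD not_le)

lemma bspline_eq_0:
  assumes "mono t" "x \<notin> {t (i - 1)..<t (i + int p)}"
  shows "bspline t p i x = 0"
  using assms(2)
proof (induction p arbitrary: i)
  case 0
  then show ?case by (simp add: indicator_def)
next
  case (Suc p)
  have "t (i + int p) \<le> t (i + 1 + int p)" "t (i - 1) \<le> t i"
    by (rule monoD[OF assms(1)], simp)+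
  then show ?case
    using Suc.prems Suc.IH[of i] Suc.IH[of "i + 1"]
    by (auto simp: algebra_simps)
qed

text \<open>In the recursion the factors \<open>\<beta>\<close> and \<open>1 - \<beta>\<close> may be negative, but only where the B-spline of lower
  degree next to them vanishes.\<close>

lemma bspline_terms_nonneg:
  assumes "mono t" "\<And>i. 0 \<le> bspline t p i x"
  shows "0 \<le> bspline_beta t (Suc p) (i - 1) x * bspline t p i x"
    and "0 \<le> (1 - bspline_beta t (Suc p) i x) * bspline t p (i + 1) x"
proof -
  show "0 \<le> bspline_beta t (Suc p) (i - 1) x * bspline t p i x"
  proof (cases "x \<in> {t (i - 1)..<t (i + int p)}")
    case True
    then show ?thesis
      using assms(2)[of i] by (auto simp: bspline_beta_def)
  qed (simp add: bspline_eq_0[OF assms(1)])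
  show "0 \<le> (1 - bspline_beta t (Suc p) i x) * bspline t p (i + 1) x"
  proof (cases "x \<in> {t i..<t (i + 1 + int p)}")
    case True
    then have "bspline_beta t (Suc p) i x \<le> 1"
      by (auto simp: bspline_beta_def algebra_simps)
    then show ?thesis
      using assms(2)[of "i + 1"] by simp
  qed (simp add: bspline_eq_0[OF assms(1)])
qed

lemma bspline_nonneg:
  assumes "mono t"
  shows "0 \<le> bspline t p i x"
proof (induction p arbitrary: i)
  case 0
  then show ?case by simp
next
  case (Suc p)
  then show ?case
    using bspline_terms_nonneg[OF assms Suc] by simp
qed

text \<open>Inside a knot interval at least one of the two terms of the recursion has a positive factor and, by
  induction, a positive B-spline; the other term is nonnegative. The end points are left out because a
  B-spline of positive degree can vanish at the left end of its support.\<close>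

lemma bspline_pos:
  assumes "mono t" "t (s - 1) < x" "x < t s" "i \<le> s" "s \<le> i + int p"
  shows "0 < bspline t p i x"
  using assms(4,5)
proof (induction p arbitrary: i)
  case 0
  then show ?case
    using assms(2,3) by simp
next
  case (Suc p)
  have lower: "t (i - 1) \<le> t (s - 1)" and upper: "t s \<le> t (i + int (Suc p))"
    using Suc.prems by (auto intro!: monoD[OF assms(1)])
  note left = bspline_terms_nonneg(1)[OF assms(1) bspline_nonneg[OF assms(1)], of p i x]
  note right = bspline_terms_nonneg(2)[OF assms(1) bspline_nonneg[OF assms(1)], of p i x]
  show ?case
  proof (cases "s \<le> i + int p")
    case True
    have "t s \<le> t (i + int p)"
      using True by (auto intro!: monoD[OF assms(1)])
    then have "0 < bspline_beta t (Suc p) (i - 1) x"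
      using lower assms(2,3) by (auto simp: bspline_beta_def)
    then have "0 < bspline_beta t (Suc p) (i - 1) x * bspline t p i x"
      using Suc.IH[of i] Suc.prems True by simp
    then show ?thesis
      using right by simp
  next
    case False
    then have s: "s = i + 1 + int p"
      using Suc.prems by simp
    have "t i \<le> t (s - 1)"
      unfolding s by (auto intro!: monoD[OF assms(1)])
    then have "0 < 1 - bspline_beta t (Suc p) i x"
      using assms(2,3) s by (auto simp: bspline_beta_def algebra_simps)
    then have "0 < (1 - bspline_beta t (Suc p) i x) * bspline t p (i + 1) x"
      using Suc.IH[of "i + 1"] s by simp
    then show ?thesis
      using left by simp
  qed
qed

text \<open>The locality behind all changes of the knot sequence below.\<close>

lemma bspline_cong:
  assumes "\<And>k. i - 1 \<le> k \<Longrightarrow> k \<le> i + int p \<Longrightarrow> t k = t' k"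
  shows "bspline t p i x = bspline t' p i x"
  using assms
proof (induction p arbitrary: i)
  case 0
  then show ?case by simp
next
  case (Suc p)
  have "bspline t p i x = bspline t' p i x" "bspline t p (i + 1) x = bspline t' p (i + 1) x"
    by (rule Suc.IH; rule Suc.prems; simp)+
  moreover have "bspline_beta t (Suc p) (i - 1) x = bspline_beta t' (Suc p) (i - 1) x"
    "bspline_beta t (Suc p) i x = bspline_beta t' (Suc p) i x"
    using Suc.prems[of "i - 1"] Suc.prems[of i] Suc.prems[of "i + int p"]
      Suc.prems[of "i + int (Suc p)"]
    by (simp_all add: bspline_beta_def)
  ultimately show ?case by simp
qed

lemma bspline_shift:
  "bspline (\<lambda>k. t (k + d)) p i x = bspline t p (i + d) x"
proof (induction p arbitrary: i)
  case 0
  then show ?case by (simp add: algebra_simps)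
next
  case (Suc p)
  then show ?case
    by (simp add: bspline_beta_def algebra_simps)
qed

lemma bspline_translate:
  "bspline (\<lambda>k. t k + c) p i (x + c) = bspline t p i x"
proof (induction p arbitrary: i)
  case 0
  then show ?case by (simp add: indicator_def)
next
  case (Suc p)
  then show ?case
    by (simp add: bspline_beta_def algebra_simps)
qed

lemma borel_measurable_bspline [measurable]: "bspline t p i \<in> borel_measurable borel"
proof (induction p arbitrary: i)
  case 0
  have "bspline t 0 i = indicator {t (i - 1)..<t i}"
    by (simp add: fun_eq_iff)
  then show ?case by simp
next
  case (Suc p)
  note [measurable] = Suc
  have [measurable]: "bspline_beta t (Suc p) i \<in> borel_measurable borel" for i
    unfolding bspline_beta_def by measurable
  have "bspline t (Suc p) i = (\<lambda>x. bspline_beta t (Suc p) (i - 1) x * bspline t p i x +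
     (1 - bspline_beta t (Suc p) i x) * bspline t p (i + 1) x)"
    by (simp add: fun_eq_iff)
  then show ?case by simp
qed

section \<open>NURBS\<close>

lemma infsum_eq_sum:
  assumes "finite F" "\<And>k. k \<notin> F \<Longrightarrow> f k = 0"
  shows "infsum f UNIV = sum f F"
proof -
  have "infsum f UNIV = infsum f F"
    by (rule infsum_cong_neutral) (use assms(2) in auto)
  then show ?thesis
    using assms(1) by simp
qed

text \<open>On \<open>[t\<^bsub>s-1\<^esub>, t\<^sub>s)\<close> only the \<open>p + 1\<close> B-splines with indices \<open>s - p, \<dots>, s\<close> can be nonzero, which turns
  all sums over the integers into finite ones.\<close>

lemma bspline_eq_0_span:
  assumes "mono t" "t (s - 1) \<le> x" "x < t s" "k \<notin> {s - int p..s}"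
  shows "bspline t p k x = 0"
proof (rule bspline_eq_0[OF assms(1)], rule notI)
  assume "x \<in> {t (k - 1)..<t (k + int p)}"
  then have "t (k - 1) < t s" "t (s - 1) < t (k + int p)"
    using assms(2,3) by auto
  then have "k - 1 < s" "s - 1 < k + int p"
    by (auto dest: mono_index_less[OF assms(1)])
  then show False
    using assms(4) by auto
qed

lemma nurbs_eq_0_span:
  assumes "mono t" "t (s - 1) \<le> x" "x < t s" "k \<notin> {s - int p..s}"
  shows "nurbs t w p k x = 0"
  using bspline_eq_0_span[OF assms] by (simp add: nurbs_def)

lemma nurbs_eq_span:
  assumes "mono t" "t (s - 1) \<le> x" "x < t s"
  shows "nurbs t w p i x = w i * bspline t p i x / (\<Sum>l\<in>{s - int p..s}. w l * bspline t p l x)"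
  unfolding nurbs_def
  by (subst infsum_eq_sum[of "{s - int p..s}"]) (use bspline_eq_0_span[OF assms] in auto)

lemma combination_eq_span:
  assumes "mono t" "t (s - 1) \<le> x" "x < t s"
  shows "infsum (\<lambda>k. c k * nurbs t w p k x) UNIV = (\<Sum>k\<in>{s - int p..s}. c k * nurbs t w p k x)"
  by (subst infsum_eq_sum[of "{s - int p..s}"]) (use nurbs_eq_0_span[OF assms] in auto)

lemma nurbs_nonneg:
  assumes "mono t" "\<forall>k. 0 < w k"
  shows "0 \<le> nurbs t w p i x"
  unfolding nurbs_def
  by (intro divide_nonneg_nonneg mult_nonneg_nonneg infsum_nonneg bspline_nonneg assms
      less_imp_le[OF assms(2)[rule_format]])

lemma nurbs_pos:
  assumes "mono t" "\<forall>k. 0 < w k" "t (s - 1) < x" "x < t s" "i \<le> s" "s \<le> i + int p"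
  shows "0 < nurbs t w p i x"
proof -
  have nonneg: "0 \<le> w l * bspline t p l x" for l
    using bspline_nonneg[OF assms(1)] assms(2) by (simp add: less_imp_le)
  have pos: "0 < w i * bspline t p i x"
    using bspline_pos[OF assms(1,3-6)] assms(2) by simp
  then have "0 < (\<Sum>l\<in>{s - int p..s}. w l * bspline t p l x)"
    by (intro sum_pos2[of _ i]) (use assms(5,6) nonneg in auto)
  then show ?thesis
    using pos assms by (subst nurbs_eq_span[of t s]) auto
qed

lemma nurbs_eq_0:
  assumes "mono t" "x \<notin> {t (i - 1)..<t (i + int p)}"
  shows "nurbs t w p i x = 0"
  using bspline_eq_0[OF assms] by (simp add: nurbs_def)

text \<open>Stated as an inequality, this also covers a vanishing denominator, where every quotient is zero by
  convention.\<close>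

lemma sum_nurbs_le_1:
  assumes "mono t" "\<forall>k. 0 < w k" "t (s - 1) \<le> x" "x < t s"
  shows "(\<Sum>k\<in>{s - int p..s}. nurbs t w p k x) \<le> 1"
proof -
  have "(\<Sum>k\<in>{s - int p..s}. nurbs t w p k x) =
    (\<Sum>k\<in>{s - int p..s}. w k * bspline t p k x) / (\<Sum>k\<in>{s - int p..s}. w k * bspline t p k x)"
    by (simp only: nurbs_eq_span[OF assms(1,3,4)] sum_divide_distrib)
  then show ?thesis by simp
qed

text \<open>With a single index this is one NURBS; with a residue class of indices it is the periodization that
  defines a function on a closed curve.\<close>

definition nurbs_part :: "(int \<Rightarrow> real) \<Rightarrow> (int \<Rightarrow> real) \<Rightarrow> nat \<Rightarrow> int set \<Rightarrow> real \<Rightarrow> real" where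
  "nurbs_part t w p C x = infsum (\<lambda>k. indicator C k * nurbs t w p k x) UNIV"

lemma nurbs_part_bounds:
  assumes "knot_sequence t" "\<forall>k. 0 < w k"
  shows "0 \<le> nurbs_part t w p C x" "nurbs_part t w p C x \<le> 1"
    and "i \<in> C \<Longrightarrow> nurbs t w p i x \<le> nurbs_part t w p C x"
    and "nurbs_part t w p C x \<noteq> 0 \<Longrightarrow> \<exists>k\<in>C. nurbs t w p k x \<noteq> 0"
proof -
  have mono: "mono t"
    using assms(1) by (simp add: knot_sequence_def)
  obtain s where s: "t (s - 1) \<le> x" "x < t s"
    using knot_span[OF assms(1)] .
  have eq: "nurbs_part t w p C x = (\<Sum>k\<in>{s - int p..s}. indicator C k * nurbs t w p k x)"
    unfolding nurbs_part_def by (rule combination_eq_span[OF mono s])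
  note nonneg = nurbs_nonneg[OF mono assms(2)]
  show ge0: "0 \<le> nurbs_part t w p C x"
    unfolding eq by (intro sum_nonneg mult_nonneg_nonneg nonneg) simp
  have "nurbs_part t w p C x \<le> (\<Sum>k\<in>{s - int p..s}. nurbs t w p k x)"
    unfolding eq by (intro sum_mono) (auto simp: indicator_def nonneg)
  also have "\<dots> \<le> 1"
    by (rule sum_nurbs_le_1[OF mono assms(2) s])
  finally show "nurbs_part t w p C x \<le> 1" .
  show "nurbs t w p i x \<le> nurbs_part t w p C x" if "i \<in> C"
  proof (cases "i \<in> {s - int p..s}")
    case True
    have "indicator C i * nurbs t w p i x \<le> nurbs_part t w p C x"
      unfolding eq by (rule member_le_sum) (use True nonneg in auto)
    then show ?thesis
      using that by simp
  next
    case False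
    then show ?thesis
      using nurbs_eq_0_span[OF mono s] ge0 by simp
  qed
  show "\<exists>k\<in>C. nurbs t w p k x \<noteq> 0" if "nurbs_part t w p C x \<noteq> 0"
  proof (rule ccontr)
    assume "\<not> ?thesis"
    then have "nurbs_part t w p C x = 0"
      unfolding eq by (intro sum.neutral) (auto simp: indicator_def)
    with that show False by simp
  qed
qed

lemma nurbs_part_singleton:
  assumes "knot_sequence t"
  shows "nurbs_part t w p {i} x = nurbs t w p i x"
  unfolding nurbs_part_def by (subst infsum_eq_sum[of "{i}"]) auto

lemma infsum_shift_int:
  fixes f :: "int \<Rightarrow> real"
  shows "infsum (\<lambda>k. f (k + d)) UNIV = infsum f UNIV"
  by (rule infsum_reindex_bij_betw) (auto intro!: bij_betwI[where g = "\<lambda>k. k - d"])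

lemma nurbs_shift:
  "nurbs (\<lambda>k. t (k + d)) (\<lambda>k. w (k + d)) p i x = nurbs t w p (i + d) x"
  unfolding nurbs_def bspline_shift
  using infsum_shift_int[of "\<lambda>l. w l * bspline t p l x" d] by simp

lemma nurbs_translate:
  "nurbs (\<lambda>k. t k + c) w p i (x + c) = nurbs t w p i x"
  unfolding nurbs_def bspline_translate ..

lemma nurbs_periodic:
  assumes "\<forall>k. t (k + d) = t k + c" "\<forall>k. w (k + d) = w k"
  shows "nurbs t w p (i + d) (x + c) = nurbs t w p i x"
proof -
  have "nurbs t w p (i + d) (x + c) = nurbs (\<lambda>k. t (k + d)) (\<lambda>k. w (k + d)) p i (x + c)"
    by (rule nurbs_shift[symmetric])
  also have "\<dots> = nurbs (\<lambda>k. t k + c) w p i (x + c)"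
    by (simp add: assms)
  finally show ?thesis
    by (simp add: nurbs_translate)
qed

lemma nurbs_part_periodic:
  assumes "\<forall>k. t (k + d) = t k + c" "\<forall>k. w (k + d) = w k" "\<forall>k. k + d \<in> C \<longleftrightarrow> k \<in> C"
  shows "nurbs_part t w p C (x + c) = nurbs_part t w p C x"
proof -
  have "nurbs_part t w p C (x + c) =
      infsum (\<lambda>k. indicator C (k + d) * nurbs t w p (k + d) (x + c)) UNIV"
    unfolding nurbs_part_def by (rule infsum_shift_int[symmetric])
  then show ?thesis
    using assms(3) by (simp add: nurbs_part_def nurbs_periodic[OF assms(1,2)] indicator_def)
qed

text \<open>The value at a point of \<open>[t\<^bsub>s-1\<^esub>, t\<^sub>s)\<close> involves every B-spline that is active there, through the
  denominator. Their indices, and hence the knots involved, do not depend on \<open>i\<close>.\<close>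

lemma nurbs_cong:
  assumes "mono t" "mono t'" "t (s - 1) \<le> x" "x < t s"
    and "\<And>k. s - int p - 1 \<le> k \<Longrightarrow> k \<le> s + int p \<Longrightarrow> t k = t' k"
    and "\<And>k. s - int p \<le> k \<Longrightarrow> k \<le> s \<Longrightarrow> w k = w' k"
  shows "nurbs t w p i x = nurbs t' w' p i x"
proof -
  have s: "t' (s - 1) \<le> x" "x < t' s"
    using assms(3,4) assms(5)[of "s - 1"] assms(5)[of s] by auto
  have eq: "w k * bspline t p k x = w' k * bspline t' p k x" if "k \<in> {s - int p..s}" for k
  proof -
    have "bspline t p k x = bspline t' p k x"
      by (rule bspline_cong) (use that assms(5) in auto)
    then show ?thesis
      using that assms(6) by simp
  qed
  show ?thesis
  proof (cases "i \<in> {s - int p..s}")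
    case True
    have "(\<Sum>l\<in>{s - int p..s}. w l * bspline t p l x) = (\<Sum>l\<in>{s - int p..s}. w' l * bspline t' p l x)"
      by (rule sum.cong[OF refl eq])
    then show ?thesis
      using eq[OF True] by (simp add: nurbs_eq_span[OF assms(1,3,4)] nurbs_eq_span[OF assms(2) s])
  next
    case False
    then show ?thesis
      using nurbs_eq_0_span[OF assms(1,3,4)] nurbs_eq_0_span[OF assms(2) s] by simp
  qed
qed

text \<open>Pointwise, the symmetric partial sums are eventually constant.\<close>

lemma borel_measurable_infsum_int:
  fixes f :: "int \<Rightarrow> real \<Rightarrow> real"
  assumes [measurable]: "\<And>k. f k \<in> borel_measurable borel"
    and fin: "\<And>x. \<exists>F. finite F \<and> (\<forall>k. k \<notin> F \<longrightarrow> f k x = 0)"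
  shows "(\<lambda>x. infsum (\<lambda>k. f k x) UNIV) \<in> borel_measurable borel"
proof (rule borel_measurable_LIMSEQ_real)
  show "(\<lambda>x. \<Sum>k\<in>{- int j..int j}. f k x) \<in> borel_measurable borel" for j
    by measurable
  fix x
  obtain F where F: "finite F" "\<And>k. k \<notin> F \<Longrightarrow> f k x = 0"
    using fin[of x] by auto
  obtain j0 where j0: "F \<subseteq> {- int j0..int j0}"
  proof
    show "F \<subseteq> {- int (nat (Max (insert 0 (abs ` F))))..int (nat (Max (insert 0 (abs ` F))))}"
    proof
      fix k assume "k \<in> F"
      then have "\<bar>k\<bar> \<le> Max (insert 0 (abs ` F))"
        using F(1) by (intro Max_ge) auto
      then show "k \<in> {- int (nat (Max (insert 0 (abs ` F))))..int (nat (Max (insert 0 (abs ` F))))}"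
        by auto
    qed
  qed
  have "(\<Sum>k\<in>{- int j..int j}. f k x) = infsum (\<lambda>k. f k x) UNIV" if "j \<ge> j0" for j
    by (rule infsum_eq_sum[symmetric]) (use F(2) j0 that in force)+
  then show "(\<lambda>j. \<Sum>k\<in>{- int j..int j}. f k x) \<longlonglongrightarrow> infsum (\<lambda>k. f k x) UNIV"
    by (intro tendsto_eventually eventually_sequentiallyI[of j0])
qed

lemma borel_measurable_nurbs:
  assumes "knot_sequence t"
  shows "nurbs t w p i \<in> borel_measurable borel"
proof -
  have mono: "mono t"
    using assms by (simp add: knot_sequence_def)
  have [measurable]: "(\<lambda>x. infsum (\<lambda>l. w l * bspline t p l x) UNIV) \<in> borel_measurable borel"
  proof (rule borel_measurable_infsum_int)
    fix x
    obtain s where s: "t (s - 1) \<le> x" "x < t s"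
      using knot_span[OF assms] .
    then show "\<exists>F. finite F \<and> (\<forall>l. l \<notin> F \<longrightarrow> w l * bspline t p l x = 0)"
      by (intro exI[of _ "{s - int p..s}"]) (use bspline_eq_0_span[OF mono s] in auto)
  qed simp
  have "nurbs t w p i = (\<lambda>x. w i * bspline t p i x / infsum (\<lambda>l. w l * bspline t p l x) UNIV)"
    by (simp add: nurbs_def fun_eq_iff)
  then show ?thesis by simp
qed

lemma borel_measurable_combination:
  assumes "knot_sequence t"
  shows "(\<lambda>x. infsum (\<lambda>k. c k * nurbs t w p k x) UNIV) \<in> borel_measurable borel"
proof (rule borel_measurable_infsum_int)
  note [measurable] = borel_measurable_nurbs[OF assms]
  show "(\<lambda>x. c k * nurbs t w p k x) \<in> borel_measurable borel" for k
    by simp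
  fix x
  have mono: "mono t"
    using assms by (simp add: knot_sequence_def)
  obtain s where s: "t (s - 1) \<le> x" "x < t s"
    using knot_span[OF assms] .
  then show "\<exists>F. finite F \<and> (\<forall>k. k \<notin> F \<longrightarrow> c k * nurbs t w p k x = 0)"
    by (intro exI[of _ "{s - int p..s}"]) (use nurbs_eq_0_span[OF mono s] in auto)
qed

text \<open>On a bounded interval only finitely many terms contribute.\<close>

text \<open>Together with measurability this gives square integrability on the curve.\<close>

lemma combination_bounded:
  assumes "knot_sequence t" "\<forall>k. 0 < w k"
  shows "\<exists>M. \<forall>x\<in>{u..v}. \<bar>infsum (\<lambda>k. c k * nurbs t w p k x) UNIV\<bar> \<le> M"
proof -
  have mono: "mono t"
    using assms(1) by (simp add: knot_sequence_def)
  obtain su where su: "t (su - 1) \<le> u" "u < t su"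
    using knot_span[OF assms(1)] .
  obtain sv where sv: "t (sv - 1) \<le> v" "v < t sv"
    using knot_span[OF assms(1)] .
  let ?F = "{su - int p..sv}"
  have "\<bar>infsum (\<lambda>k. c k * nurbs t w p k x) UNIV\<bar> \<le> (\<Sum>k\<in>?F. \<bar>c k\<bar>)" if x: "x \<in> {u..v}" for x
  proof -
    obtain s where s: "t (s - 1) \<le> x" "x < t s"
      using knot_span[OF assms(1)] .
    have "t (su - 1) < t s" "t (s - 1) < t sv"
      using su sv s x by auto
    then have sub: "{s - int p..s} \<subseteq> ?F"
      by (auto dest!: mono_index_less[OF mono])
    have le1: "nurbs t w p k x \<le> 1" for k
      using nurbs_part_bounds(3)[OF assms, of k "{k}" p x]
        nurbs_part_bounds(2)[OF assms, of p "{k}" x] by simp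
    have "\<bar>infsum (\<lambda>k. c k * nurbs t w p k x) UNIV\<bar> \<le> (\<Sum>k\<in>{s - int p..s}. \<bar>c k * nurbs t w p k x\<bar>)"
      unfolding combination_eq_span[OF mono s] by (rule sum_abs)
    also have "\<dots> \<le> (\<Sum>k\<in>{s - int p..s}. \<bar>c k\<bar>)"
      using nurbs_nonneg[OF mono assms(2)] le1
      by (intro sum_mono) (simp add: abs_mult mult_left_le)
    also have "\<dots> \<le> (\<Sum>k\<in>?F. \<bar>c k\<bar>)"
      by (rule sum_mono2) (use sub in auto)
    finally show ?thesis .
  qed
  then show ?thesis by blast
qed

lemma borel_measurable_nurbs_part [measurable]:
  assumes "knot_sequence t"
  shows "nurbs_part t w p C \<in> borel_measurable borel"
  using borel_measurable_combination[OF assms, of "indicator C" w p]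
  by (simp add: nurbs_part_def[abs_def])

section \<open>Meshes and their knots\<close>

text \<open>A parameter interval of an element, possibly translated. On a closed curve the translation is by a
  multiple of the period; on an open curve it is zero. The condition on \<open>\<gamma>\<close> says that both
  intervals have the same image.\<close>

definition mesh_span :: "(real \<Rightarrow> real^2) \<Rightarrow> nat \<Rightarrow> (nat \<Rightarrow> real) \<Rightarrow> real \<Rightarrow> real \<Rightarrow> bool" where
  "mesh_span \<gamma> n z u v \<longleftrightarrow>
     (\<exists>j\<in>{1..n}. \<exists>c. u = z (j - 1) + c \<and> v = z j + c \<and> (\<forall>x\<in>{u..v}. \<gamma> (x - c) = \<gamma> x))"

text \<open>The common description of the periodic knots of a closed curve and of the finitely many knots of an
  open one: between the indices \<open>lo\<close> and \<open>hi\<close>, the distinct knots run through the nodes without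
  skipping any.\<close>

definition knots_on_mesh ::
  "(real \<Rightarrow> real^2) \<Rightarrow> nat \<Rightarrow> (nat \<Rightarrow> real) \<Rightarrow> (int \<Rightarrow> real) \<Rightarrow> int \<Rightarrow> int \<Rightarrow> bool" where
  "knots_on_mesh \<gamma> n z t lo hi \<longleftrightarrow>
     (\<forall>s\<in>{lo<..hi}. t (s - 1) < t s \<longrightarrow> mesh_span \<gamma> n z (t (s - 1)) (t s))"

lemma mesh_span_element:
  assumes "mesh_span \<gamma> n z u v" "u \<le> v"
  obtains S where "S \<in> param_mesh n z" "\<gamma> ` S = \<gamma> ` {u..v}" "measure lborel S = v - u"
proof -
  obtain j c where j: "j \<in> {1..n}" and c: "u = z (j - 1) + c" "v = z j + c"
    and eq: "\<And>x. x \<in> {u..v} \<Longrightarrow> \<gamma> (x - c) = \<gamma> x"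
    using assms(1) unfolding mesh_span_def by blast
  have "{z (j - 1)..z j} = (\<lambda>x. x - c) ` {u..v}"
    using c by (auto simp: image_iff intro!: bexI[of _ "_ + c"])
  then have "\<gamma> ` {z (j - 1)..z j} = (\<lambda>x. \<gamma> (x - c)) ` {u..v}"
    by (simp only: image_image)
  also have "\<dots> = \<gamma> ` {u..v}"
    by (rule image_cong[OF refl eq])
  finally have "\<gamma> ` {z (j - 1)..z j} = \<gamma> ` {u..v}" .
  then show ?thesis
    using that[of "{z (j - 1)..z j}"] j c assms(2) by (auto simp: param_mesh_def)
qed

lemma mesh_span_continuous:
  assumes "mesh_span \<gamma> n z u v" "continuous_on {a..b} \<gamma>" "z ` {0..n} \<subseteq> {a..b}"
  shows "continuous_on {u..v} \<gamma>"
proof -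
  obtain j c where j: "j \<in> {1..n}" and c: "u = z (j - 1) + c" "v = z j + c"
    and eq: "\<And>x. x \<in> {u..v} \<Longrightarrow> \<gamma> (x - c) = \<gamma> x"
    using assms(1) unfolding mesh_span_def by blast
  have "z (j - 1) \<in> {a..b}" "z j \<in> {a..b}"
    using j assms(3) by (force simp: image_subset_iff)+
  then have "continuous_on {u..v} (\<lambda>x. \<gamma> (x - c))"
    using c by (intro continuous_on_compose2[OF assms(2)] continuous_intros) auto
  then show ?thesis
    by (rule continuous_on_eq) (rule eq)
qed

text \<open>Only the continuity of \<open>\<gamma>\<close> on \<open>[a, b]\<close> is assumed, while \<open>[t\<^bsub>lo\<^esub>, t\<^sub>k]\<close> may leave \<open>[a, b]\<close>: the pieces are
  glued at the knots.\<close>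

lemma knots_continuous:
  assumes "mono t" "knots_on_mesh \<gamma> n z t lo hi"
    and "continuous_on {a..b} \<gamma>" "z ` {0..n} \<subseteq> {a..b}"
    and "lo \<le> k" "k \<le> hi"
  shows "continuous_on {t lo..t k} \<gamma>"
  using assms(5,6)
proof (induction k rule: int_ge_induct)
  case base
  then show ?case by simp
next
  case (step k)
  have le: "t lo \<le> t k" "t k \<le> t (k + 1)"
    using step.hyps by (auto intro: monoD[OF assms(1)])
  have "continuous_on {t k..t (k + 1)} \<gamma>"
  proof (cases "t k < t (k + 1)")
    case True
    then have "mesh_span \<gamma> n z (t k) (t (k + 1))"
      using assms(2) step by (auto simp: knots_on_mesh_def dest!: bspec[where x = "k + 1"])
    then show ?thesis
      by (rule mesh_span_continuous[OF _ assms(3,4)])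
  next
    case False
    then show ?thesis
      using le by simp
  qed
  then have "continuous_on ({t lo..t k} \<union> {t k..t (k + 1)}) \<gamma>"
    using step by (intro continuous_on_closed_Un) auto
  then show ?case
    using le by (simp add: ivl_disj_un_two_touch)
qed

lemma knots_on_mesh_mono:
  assumes "knots_on_mesh \<gamma> n z t lo hi" "lo \<le> lo'" "hi' \<le> hi"
  shows "knots_on_mesh \<gamma> n z t lo' hi'"
  using assms by (auto simp: knots_on_mesh_def)

text \<open>Apart from the first step, a patch is a union of elements, each of which meets that patch.\<close>

lemma patch_Suc_superset:
  assumes "T \<in> M"
  shows "patch M k T \<subseteq> patch M (Suc k) T"
proof (induction k)
  case 0
  then show ?case using assms by auto
next
  case (Suc k)
  show ?case
  proof
    fix x assume x: "x \<in> patch M (Suc k) T"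
    then obtain T' where "T' \<in> M" "x \<in> T'"
      by auto
    then show "x \<in> patch M (Suc (Suc k)) T"
      using x by (subst patch.simps) blast
  qed
qed

lemma patch_mono:
  assumes "T \<in> M" "k \<le> k'"
  shows "patch M k T \<subseteq> patch M k' T"
  by (rule lift_Suc_mono_le[of "\<lambda>k. patch M k T", OF patch_Suc_superset[OF assms(1)] assms(2)])

lemma patch_absorbs:
  assumes "T' \<in> M" "x \<in> T'" "x \<in> patch M k T"
  shows "T' \<subseteq> patch M (Suc k) T"
  using assms by auto

text \<open>Each knot interval next to a part of the patch shares a knot with it. Its image is a point or
  an element, so that one more step of the patch absorbs it.\<close>

lemma patch_knots:
  assumes "mono t" "knots_on_mesh \<gamma> n z t lo hi" "\<gamma> ` {t (l - 1)..t l} \<in> mesh \<gamma> n z"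
  shows "lo \<le> l - 1 - int k \<Longrightarrow> l \<le> hi \<Longrightarrow>
      \<gamma> ` {t (l - 1 - int k)..t l} \<subseteq> patch (mesh \<gamma> n z) k (\<gamma> ` {t (l - 1)..t l})"
    and "lo < l \<Longrightarrow> l + int k \<le> hi \<Longrightarrow>
      \<gamma> ` {t (l - 1)..t (l + int k)} \<subseteq> patch (mesh \<gamma> n z) k (\<gamma> ` {t (l - 1)..t l})"
proof -
  let ?P = "\<lambda>k. patch (mesh \<gamma> n z) k (\<gamma> ` {t (l - 1)..t l})"
  have grow: "\<gamma> ` {t (s - 1)..t s} \<subseteq> ?P (Suc k)"
    if "s \<in> {lo<..hi}" "y \<in> {t (s - 1)..t s}" "\<gamma> y \<in> ?P k" for s k y
  proof (cases "t (s - 1) < t s")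
    case True
    then have "mesh_span \<gamma> n z (t (s - 1)) (t s)"
      using assms(2) that(1) by (auto simp: knots_on_mesh_def)
    then obtain S where "S \<in> param_mesh n z" "\<gamma> ` S = \<gamma> ` {t (s - 1)..t s}"
      using True by (auto elim!: mesh_span_element)
    then have "\<gamma> ` {t (s - 1)..t s} \<in> mesh \<gamma> n z"
      by (metis imageI mesh_def)
    then show ?thesis
      using that by (intro patch_absorbs[of _ _ "\<gamma> y"]) auto
  next
    case False
    then have "{t (s - 1)..t s} \<subseteq> {y}"
      using that(2) by auto
    then show ?thesis
      using that(3) patch_Suc_superset[OF assms(3), of k] by blast
  qed
  show "\<gamma> ` {t (l - 1 - int k)..t l} \<subseteq> ?P k" if "lo \<le> l - 1 - int k" "l \<le> hi"
    using that
  proof (induction k)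
    case 0
    then show ?case by simp
  next
    case (Suc k)
    let ?s = "l - 1 - int k"
    have IH: "\<gamma> ` {t ?s..t l} \<subseteq> ?P k"
      using Suc by simp
    have le: "t (?s - 1) \<le> t ?s" "t ?s \<le> t l"
      by (rule monoD[OF assms(1)], simp)+
    then have split: "{t (?s - 1)..t l} = {t (?s - 1)..t ?s} \<union> {t ?s..t l}"
      by (rule ivl_disj_un_two_touch(4)[symmetric])
    have "\<gamma> ` {t (?s - 1)..t ?s} \<subseteq> ?P (Suc k)"
    proof (rule grow[of _ "t ?s"])
      show "\<gamma> (t ?s) \<in> ?P k"
        using IH le by auto
    qed (use Suc.prems le in auto)
    moreover have "\<gamma> ` {t ?s..t l} \<subseteq> ?P (Suc k)"
      using IH patch_Suc_superset[OF assms(3), of k] by blast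
    moreover have "l - 1 - int (Suc k) = ?s - 1"
      by simp
    ultimately show ?case
      by (simp only: split image_Un Un_least)
  qed
  show "\<gamma> ` {t (l - 1)..t (l + int k)} \<subseteq> ?P k" if "lo < l" "l + int k \<le> hi"
    using that
  proof (induction k)
    case 0
    then show ?case by simp
  next
    case (Suc k)
    let ?s = "l + int (Suc k)"
    have IH: "\<gamma> ` {t (l - 1)..t (?s - 1)} \<subseteq> ?P k"
      using Suc by simp
    have le: "t (l - 1) \<le> t (?s - 1)" "t (?s - 1) \<le> t ?s"
      by (rule monoD[OF assms(1)], simp)+
    then have split: "{t (l - 1)..t ?s} = {t (l - 1)..t (?s - 1)} \<union> {t (?s - 1)..t ?s}"
      by (rule ivl_disj_un_two_touch(4)[symmetric])
    have "\<gamma> ` {t (?s - 1)..t ?s} \<subseteq> ?P (Suc k)"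
    proof (rule grow[of _ "t (?s - 1)"])
      show "\<gamma> (t (?s - 1)) \<in> ?P k"
        using IH le by auto
    qed (use Suc.prems le in auto)
    moreover have "\<gamma> ` {t (l - 1)..t (?s - 1)} \<subseteq> ?P (Suc k)"
      using IH patch_Suc_superset[OF assms(3), of k] by blast
    ultimately show ?case
      by (simp only: split image_Un Un_least)
  qed
qed

lemma mesh_ratio_ge:
  assumes "S \<in> param_mesh n z" "S' \<in> param_mesh n z" "\<gamma> ` S \<inter> \<gamma> ` S' \<noteq> {}"
  shows "measure lborel S / measure lborel S' \<le> mesh_ratio \<gamma> (param_mesh n z)"
proof -
  have "finite (param_mesh n z)"
    by (simp add: param_mesh_def)
  then have "finite ((\<lambda>(S, S'). measure lborel S / measure lborel S') ` (param_mesh n z \<times> param_mesh n z))"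
    by simp
  then have "finite {measure lborel S / measure lborel S' | S S'. S \<in> param_mesh n z \<and>
      S' \<in> param_mesh n z \<and> \<gamma> ` S \<inter> \<gamma> ` S' \<noteq> {}}"
    by (rule rev_finite_subset) auto
  then show ?thesis
    unfolding mesh_ratio_def by (rule Max_ge) (use assms in blast)
qed

text \<open>If \<open>x < y < v\<close> are neighbouring knot values, then the first and the last index with value \<open>y\<close> end
  and begin the knot intervals \<open>[x, y]\<close> and \<open>[y, v]\<close>. These come from elements that meet in \<open>\<gamma>(y)\<close>,
  which is the situation measured by the mesh ratio.\<close>

lemma knots_ratio:
  assumes "mono t" "knots_on_mesh \<gamma> n z t lo hi"
    and "x \<in> t ` {lo..hi}" "y \<in> t ` {lo..hi}" "v \<in> t ` {lo..hi}" "x < y" "y < v"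
    and gap: "t ` {lo..hi} \<inter> {x<..<v} = {y}"
  shows "(v - y) / (y - x) \<le> mesh_ratio \<gamma> (param_mesh n z)"
    and "(y - x) / (v - y) \<le> mesh_ratio \<gamma> (param_mesh n z)"
proof -
  let ?K = "{k\<in>{lo..hi}. t k = y}"
  have K: "finite ?K" "?K \<noteq> {}"
    using assms(4) by (auto intro: finite_subset[of _ "{lo..hi}"])
  obtain kx kv where kx: "kx \<in> {lo..hi}" "t kx = x" and kv: "kv \<in> {lo..hi}" "t kv = v"
    using assms(3,5) by auto
  define k where "k = Min ?K"
  define k' where "k' = Max ?K"
  have k: "k \<in> {lo..hi}" "t k = y" and k': "k' \<in> {lo..hi}" "t k' = y"
    using Min_in[OF K] Max_in[OF K] by (auto simp: k_def k'_def)
  have "kx < k" "k' < kv"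
    using kx kv k k' assms(6,7) by (auto intro: mono_index_less[OF assms(1)])
  then have range: "k - 1 \<in> {lo..hi}" "k' + 1 \<in> {lo..hi}"
    using k k' kx kv by auto
  have "k - 1 \<notin> ?K"
    using Min_le[OF K(1), of "k - 1"] by (auto simp: k_def)
  then have "t (k - 1) \<noteq> y"
    using range by simp
  moreover have "x \<le> t (k - 1)" "t (k - 1) \<le> y"
    unfolding kx(2)[symmetric] k(2)[symmetric] using \<open>kx < k\<close> by (auto intro!: monoD[OF assms(1)])
  ultimately have left: "t (k - 1) = x"
    using gap range(1) assms(6,7) by (force simp: set_eq_iff)
  have "k' + 1 \<notin> ?K"
    using Max_ge[OF K(1), of "k' + 1"] by (auto simp: k'_def)
  then have "t (k' + 1) \<noteq> y"
    using range by simp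
  moreover have "t (k' + 1) \<le> v" "y \<le> t (k' + 1)"
    unfolding kv(2)[symmetric] k'(2)[symmetric] using \<open>k' < kv\<close> by (auto intro!: monoD[OF assms(1)])
  ultimately have right: "t (k' + 1) = v"
    using gap range(2) assms(6,7) by (force simp: set_eq_iff)
  have "mesh_span \<gamma> n z x y"
    using assms(2) range(1) k left assms(6) unfolding knots_on_mesh_def
    by (auto dest!: bspec[where x = k])
  then obtain S where S: "S \<in> param_mesh n z" "\<gamma> ` S = \<gamma> ` {x..y}" "measure lborel S = y - x"
    using assms(6) by (auto elim!: mesh_span_element)
  have "mesh_span \<gamma> n z y v"
    using assms(2) range(2) k' right assms(7) unfolding knots_on_mesh_def
    by (auto dest!: bspec[where x = "k' + 1"])
  then obtain S' where S': "S' \<in> param_mesh n z" "\<gamma> ` S' = \<gamma> ` {y..v}" "measure lborel S' = v - y"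
    using assms(7) by (auto elim!: mesh_span_element)
  have meet: "\<gamma> y \<in> \<gamma> ` S" "\<gamma> y \<in> \<gamma> ` S'"
    using S(2) S'(2) assms(6,7) by auto
  show "(v - y) / (y - x) \<le> mesh_ratio \<gamma> (param_mesh n z)"
    unfolding S(3)[symmetric] S'(3)[symmetric] by (rule mesh_ratio_ge[OF S'(1) S(1)]) (use meet in blast)
  show "(y - x) / (v - y) \<le> mesh_ratio \<gamma> (param_mesh n z)"
    unfolding S(3)[symmetric] S'(3)[symmetric] by (rule mesh_ratio_ge[OF S(1) S'(1)]) (use meet in blast)
qed

text \<open>For closed \<open>\<Gamma>\<close> only the nodes in \<open>(a, b]\<close> carry a multiplicity, and \<open>t\<^sub>0 = a\<close> follows from periodicity.
  With these facts the two kinds of curves no longer differ on \<open>[a, b]\<close>.\<close>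

lemma mesh_knots_endpoints:
  assumes "is_mesh cl a b \<gamma> n z" "mesh_knots cl a b n z p mlt N t" "a < b"
  shows "0 < N" "t 0 = a" "t (int N) = b" "t ` {0..int N} = z ` {0..n}"
proof -
  have z: "z 0 = a" "z n = b" and z_mono: "strict_mono_on {0..n} z"
    using assms(1) by (auto simp: is_mesh_def)
  then have "n \<noteq> 0"
    using assms(3) by (intro notI) simp
  have mono: "mono t"
    using assms(2) by (simp add: mesh_knots_def knot_sequence_def)
  let ?lo = "if cl then 1 else 0 :: int"
  have knots_in: "\<And>i. i \<in> {?lo..int N} \<Longrightarrow> t i \<in> nodes cl n z"
    and cards: "\<And>x. x \<in> nodes cl n z \<Longrightarrow> card {i\<in>{?lo..int N}. t i = x} \<noteq> 0"
  proof -
    show "t i \<in> nodes cl n z" if "i \<in> {?lo..int N}" for i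
      using assms(2) that by (simp only: mesh_knots_def)
    fix x assume "x \<in> nodes cl n z"
    then have "card {i\<in>{?lo..int N}. t i = x} = mlt x" "mlt x \<in> {1..p + 1}"
      using assms(2) by (simp_all only: mesh_knots_def)
    then show "card {i\<in>{?lo..int N}. t i = x} \<noteq> 0"
      by simp
  qed
  have attained: "\<exists>i\<in>{?lo..int N}. t i = x" if "x \<in> nodes cl n z" for x
  proof (rule ccontr)
    assume "\<not> ?thesis"
    then have none: "{i\<in>{?lo..int N}. t i = x} = {}"
      by blast
    show False
      using cards[OF that] unfolding none by simp
  qed
  have range: "t ` {?lo..int N} = nodes cl n z"
  proof
    show "t ` {?lo..int N} \<subseteq> nodes cl n z"
      using knots_in by (auto simp only: image_subset_iff)
    show "nodes cl n z \<subseteq> t ` {?lo..int N}"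
      using attained by blast
  qed
  have bounds: "x \<le> b" "a \<le> x" if x: "x \<in> z ` {0..n}" for x
  proof -
    obtain j where "j \<in> {0..n}" "x = z j"
      using x by blast
    then show "x \<le> b" "a \<le> x"
      using strict_mono_on_leD[OF z_mono, of j n] strict_mono_on_leD[OF z_mono, of 0 j] z by auto
  qed
  have nodes_sub: "nodes cl n z \<subseteq> z ` {0..n}"
    by (auto simp: nodes_def)
  have "b \<in> nodes cl n z"
    using z \<open>n \<noteq> 0\<close> by (auto simp: nodes_def image_iff intro: bexI[of _ n])
  then obtain ib where ib: "ib \<in> {?lo..int N}" "t ib = b"
    using attained by blast
  then have "b \<le> t (int N)"
    using monoD[OF mono, of ib "int N"] by auto
  moreover have "t (int N) \<in> z ` {0..n}"
    using knots_in[of "int N"] nodes_sub ib by auto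
  ultimately show tN: "t (int N) = b"
    using bounds by force
  have t0: "t 0 = a"
  proof (cases cl)
    case True
    then have "t (0 + int N) = t 0 + (b - a)"
      using assms(2) unfolding mesh_knots_def by metis
    then show ?thesis
      using tN by simp
  next
    case False
    then have "a \<in> nodes cl n z"
      using z by (auto simp: nodes_def image_iff intro: bexI[of _ 0])
    then obtain i where "i \<in> {?lo..int N}" "t i = a"
      using attained by blast
    then have "t 0 \<le> a"
      using monoD[OF mono, of 0 i] False by auto
    moreover have "t 0 \<in> z ` {0..n}"
      using knots_in[of 0] nodes_sub False by auto
    ultimately show ?thesis
      using bounds by force
  qed
  then show "t 0 = a" .
  show "0 < N"
    using t0 tN assms(3) by (cases N) auto
  show "t ` {0..int N} = z ` {0..n}"
  proof (cases cl)
    case True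
    have "{0..int N} = insert 0 {1..int N}" "{0..n} = insert 0 {1..n}"
      by auto
    then show ?thesis
      using range True t0 z by (simp add: nodes_def)
  next
    case False
    then show ?thesis
      using range by (simp add: nodes_def)
  qed
qed

text \<open>Every node is a knot, so no node lies strictly between two consecutive knots.\<close>

lemma knot_span_element:
  assumes "is_mesh cl a b \<gamma> n z" "mesh_knots cl a b n z p mlt N t" "a < b"
    and "s \<in> {1..int N}" "t (s - 1) < t s"
  shows "\<exists>j\<in>{1..n}. t (s - 1) = z (j - 1) \<and> t s = z j"
proof -
  note ends = mesh_knots_endpoints[OF assms(1-3)]
  have z_mono: "strict_mono_on {0..n} z"
    using assms(1) by (auto simp: is_mesh_def)
  have mono: "mono t"
    using assms(2) by (simp add: mesh_knots_def knot_sequence_def)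
  have "t s \<in> z ` {0..n}" "t (s - 1) \<in> z ` {0..n}"
    unfolding ends(4)[symmetric] using assms(4) by auto
  then obtain j i where j: "j \<in> {0..n}" "t s = z j" and i: "i \<in> {0..n}" "t (s - 1) = z i"
    by auto
  have "i < j"
    using assms(5) j i strict_mono_on_leD[OF z_mono, of j i] by (metis not_le)
  \<comment> \<open>A node between \<open>z\<^sub>i\<close> and \<open>z\<^sub>j\<close> would be a knot with an index between \<open>s - 1\<close> and \<open>s\<close>.\<close>
  have "i = j - 1"
  proof (rule ccontr)
    assume "i \<noteq> j - 1"
    then have lt: "i < j - 1" "j - 1 < j"
      using \<open>i < j\<close> by auto
    then have "z i < z (j - 1)" "z (j - 1) < z j"
      using i j by (auto intro!: strict_mono_onD[OF z_mono])
    moreover have "z (j - 1) \<in> t ` {0..int N}"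
      unfolding ends(4) using j by auto
    ultimately obtain k where "t (s - 1) < t k" "t k < t s"
      using i j by auto
    then have "s - 1 < k" "k < s"
      by (auto intro: mono_index_less[OF mono])
    then show False by simp
  qed
  then show ?thesis
    using \<open>i < j\<close> i j by (intro bexI[of _ j]) auto
qed

text \<open>The first knot at the right end point of the element ends the required interval.\<close>

lemma element_knot_span:
  assumes "is_mesh cl a b \<gamma> n z" "mesh_knots cl a b n z p mlt N t" "a < b" "j \<in> {1..n}"
  shows "\<exists>l\<in>{1..int N}. t (l - 1) = z (j - 1) \<and> t l = z j"
proof -
  note ends = mesh_knots_endpoints[OF assms(1-3)]
  have z_mono: "strict_mono_on {0..n} z" and z0: "z 0 = a"
    using assms(1) by (auto simp: is_mesh_def)
  have mono: "mono t"
    using assms(2) by (simp add: mesh_knots_def knot_sequence_def)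
  have "z j \<in> t ` {0..int N}"
    unfolding ends(4) using assms(4) by auto
  let ?K = "{k\<in>{0..int N}. t k = z j}"
  have K: "finite ?K" "?K \<noteq> {}"
    using \<open>z j \<in> t ` {0..int N}\<close> by (auto intro: finite_subset[of _ "{0..int N}"])
  define l where "l = Min ?K"
  have l: "l \<in> {0..int N}" "t l = z j"
    using Min_in[OF K] by (auto simp: l_def)
  have "a < z j"
    unfolding z0[symmetric] using assms(4) by (intro strict_mono_onD[OF z_mono]) auto
  then have "l \<noteq> 0"
    using l ends(2) by auto
  then have l1: "l \<in> {1..int N}"
    using l by auto
  have "l - 1 \<notin> ?K"
    using Min_le[OF K(1), of "l - 1"] by (auto simp: l_def)
  then have "t (l - 1) \<noteq> t l"
    using l l1 by auto
  then have "t (l - 1) < t l"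
    using monoD[OF mono, of "l - 1" l] by simp
  from knot_span_element[OF assms(1-3) l1 this]
  obtain j' where j': "j' \<in> {1..n}" "t (l - 1) = z (j' - 1)" "t l = z j'"
    by blast
  have "z j' = z j"
    using j' l by simp
  then have "j' = j"
    using assms(4) j'(1) strict_mono_on_imp_inj_on[OF z_mono] by (auto dest: inj_onD)
  then show ?thesis
    using j' l1 by blast
qed

lemma periodic_int:
  fixes f :: "real \<Rightarrow> 'a" and k :: int
  assumes "\<forall>x. f (x + T) = f x"
  shows "f (x + of_int k * T) = f x"
proof (induction k arbitrary: x rule: int_induct[where k = 0])
  case base
  then show ?case by simp
next
  case (step1 i)
  have "f (x + of_int (i + 1) * T) = f ((x + of_int i * T) + T)"
    by (simp add: algebra_simps)
  then show ?case
    using step1 assms by simp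
next
  case (step2 i)
  have "f (x + of_int (i - 1) * T) = f ((x + of_int (i - 1) * T) + T)"
    by (rule assms[rule_format, symmetric])
  also have "\<dots> = f (x + of_int i * T)"
    by (simp add: algebra_simps)
  finally show ?case
    using step2 by simp
qed

lemma periodic_representative:
  fixes a b x :: real
  assumes "a < b"
  obtains y k where "y \<in> {a..<b}" "x = y + of_int k * (b - a)"
proof
  let ?k = "\<lfloor>(x - a) / (b - a)\<rfloor>"
  show "x = (x - of_int ?k * (b - a)) + of_int ?k * (b - a)"
    by simp
  have "of_int ?k \<le> (x - a) / (b - a)" "(x - a) / (b - a) < of_int ?k + 1"
    by linarith+
  then have "of_int ?k * (b - a) \<le> x - a" "x - a < (of_int ?k + 1) * (b - a)"
    using assms by (simp_all only: pos_le_divide_eq pos_divide_less_eq diff_gt_0_iff_gt)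
  then show "x - of_int ?k * (b - a) \<in> {a..<b}"
    by (simp add: distrib_right)
qed

lemma knots_periodic_int:
  fixes t :: "int \<Rightarrow> real" and k :: int
  assumes "\<forall>i. t (i + d) = t i + c"
  shows "t (i + k * d) = t i + of_int k * c"
proof (induction k rule: int_induct[where k = 0])
  case base
  then show ?case by simp
next
  case (step1 k)
  have "t (i + (k + 1) * d) = t ((i + k * d) + d)"
    by (simp add: algebra_simps)
  also have "\<dots> = t (i + k * d) + c"
    by (rule assms[rule_format])
  finally show ?case
    using step1 by (simp add: algebra_simps)
next
  case (step2 k)
  have "t (i + (k - 1) * d) + c = t ((i + (k - 1) * d) + d)"
    by (rule assms[rule_format, symmetric])
  also have "\<dots> = t (i + k * d)"
    by (simp add: algebra_simps)
  finally show ?case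
    using step2 by (simp add: algebra_simps)
qed

lemma index_mod:
  fixes s :: int
  assumes "0 < N"
  obtains s' k where "s' \<in> {1..int N}" "s = s' + k * int N"
proof
  show "(s - 1) mod int N + 1 \<in> {1..int N}"
    using assms by (auto simp: add1_zle_eq)
  show "s = (s - 1) mod int N + 1 + (s - 1) div int N * int N"
    by simp
qed

lemma knots_on_mesh_closed:
  assumes "is_mesh True a b \<gamma> n z" "mesh_knots True a b n z p mlt N t" "a < b"
    and per: "\<forall>x. \<gamma> (x + (b - a)) = \<gamma> x"
  shows "knots_on_mesh \<gamma> n z t lo hi"
  unfolding knots_on_mesh_def
proof (intro ballI impI)
  fix s assume lt: "t (s - 1) < t s"
  have t_per: "\<forall>i. t (i + int N) = t i + (b - a)"
    using assms(2) by (simp add: mesh_knots_def)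
  obtain s' k where s': "s' \<in> {1..int N}" "s = s' + k * int N"
    using index_mod[OF mesh_knots_endpoints(1)[OF assms(1-3)]] .
  let ?c = "of_int k * (b - a)"
  have eq: "t s = t s' + ?c" "t (s - 1) = t (s' - 1) + ?c"
    using knots_periodic_int[OF t_per, of s' k] knots_periodic_int[OF t_per, of "s' - 1" k]
    by (simp_all add: s' algebra_simps)
  with lt have "t (s' - 1) < t s'"
    by simp
  from knot_span_element[OF assms(1-3) s'(1) this]
  obtain j where j: "j \<in> {1..n}" "t (s' - 1) = z (j - 1)" "t s' = z j"
    by blast
  have "\<gamma> (x - ?c) = \<gamma> x" for x
    using periodic_int[OF per, of "x - ?c" k] by simp
  then show "mesh_span \<gamma> n z (t (s - 1)) (t s)"
    unfolding mesh_span_def using j eq by (intro bexI[of _ j] exI[of _ ?c]) auto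
qed

lemma knots_on_mesh_given:
  assumes "is_mesh cl a b \<gamma> n z" "mesh_knots cl a b n z p mlt N t" "a < b"
  shows "knots_on_mesh \<gamma> n z t 0 (int N)"
  unfolding knots_on_mesh_def
proof (intro ballI impI)
  fix s assume "s \<in> {0<..int N}" and lt: "t (s - 1) < t s"
  then have "s \<in> {1..int N}"
    by auto
  from knot_span_element[OF assms this lt]
  obtain j where "j \<in> {1..n}" "t (s - 1) = z (j - 1)" "t s = z j"
    by blast
  then show "mesh_span \<gamma> n z (t (s - 1)) (t s)"
    unfolding mesh_span_def by (intro bexI[of _ j] exI[of _ 0]) auto
qed

text \<open>The first \<open>p\<close> knots beyond either end are moved to \<open>a = t\<^sub>0\<close> and \<open>b = t\<^sub>N\<close>, which is as many as the
  NURBS constant looks at; afterwards the knots move away with slope one, so that they are unbounded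
  in both directions.\<close>

definition clamped_knots :: "nat \<Rightarrow> nat \<Rightarrow> (int \<Rightarrow> real) \<Rightarrow> int \<Rightarrow> real" where
  "clamped_knots p N t k =
     (if k < 0 then min (t 0) (t 0 + of_int (k + int p))
      else if int N < k then max (t (int N)) (t (int N) + of_int (k - int N - int p))
      else t k)"

lemma knot_sequence_clamped:
  assumes "mono t"
  shows "knot_sequence (clamped_knots p N t)"
proof -
  let ?t = "clamped_knots p N t"
  have "?t i \<le> ?t j" if "i \<le> j" for i j
  proof -
    have "t 0 \<le> t (int N)" "0 \<le> i \<Longrightarrow> t 0 \<le> t i" "j \<le> int N \<Longrightarrow> t j \<le> t (int N)" "t i \<le> t j"
      "0 \<le> j \<Longrightarrow> t 0 \<le> t j" "i \<le> int N \<Longrightarrow> t i \<le> t (int N)"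
      using that by (auto intro: monoD[OF assms])
    moreover have "real_of_int i \<le> real_of_int j"
      using that by simp
    ultimately show ?thesis
      using that by (auto simp: clamped_knots_def min_def max_def)
  qed
  moreover have "filterlim ?t at_top at_top"
    unfolding filterlim_at_top
  proof
    fix Z
    show "eventually (\<lambda>k. Z \<le> ?t k) at_top"
      unfolding eventually_at_top_linorder
    proof (intro exI allI impI)
      fix k assume k: "max (int N + 1) (\<lceil>Z - t (int N)\<rceil> + int N + int p) \<le> k"
      then have "Z - t (int N) \<le> of_int (k - int N - int p)"
        by (simp add: ceiling_le_iff[symmetric] del: of_int_diff)
      then show "Z \<le> ?t k"
        using k by (auto simp: clamped_knots_def)
    qed
  qed
  moreover have "filterlim ?t at_bot at_bot"
    unfolding filterlim_at_bot
  proof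
    fix Z
    show "eventually (\<lambda>k. ?t k \<le> Z) at_bot"
      unfolding eventually_at_bot_linorder
    proof (intro exI allI impI)
      fix k assume k: "k \<le> min (-1) (\<lfloor>Z - t 0\<rfloor> - int p)"
      then have "of_int (k + int p) \<le> Z - t 0"
        by (simp add: le_floor_iff[symmetric] del: of_int_add)
      then show "?t k \<le> Z"
        using k by (auto simp: clamped_knots_def)
    qed
  qed
  ultimately show ?thesis
    by (auto simp: knot_sequence_def monoI)
qed

lemma clamped_knots_eq:
  "0 \<le> k \<Longrightarrow> k \<le> int N \<Longrightarrow> clamped_knots p N t k = t k"
  "- int p \<le> k \<Longrightarrow> k \<le> 0 \<Longrightarrow> clamped_knots p N t k = t 0"
  "int N \<le> k \<Longrightarrow> k \<le> int N + int p \<Longrightarrow> clamped_knots p N t k = t (int N)"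
proof -
  assume "- int p \<le> k" "k \<le> 0"
  then have "0 \<le> real_of_int (k + int p)" by linarith
  then show "clamped_knots p N t k = t 0"
    using \<open>k \<le> 0\<close> by (cases "k = 0") (auto simp: clamped_knots_def)
next
  assume "int N \<le> k" "k \<le> int N + int p"
  then have "real_of_int (k - int N - int p) \<le> 0" by linarith
  then show "clamped_knots p N t k = t (int N)"
    using \<open>int N \<le> k\<close> by (auto simp: clamped_knots_def)
qed (simp add: clamped_knots_def)

lemma clamped_knots_range:
  assumes "mono t" "- int p \<le> k" "k \<le> int N + int p"
  shows "clamped_knots p N t k \<in> {t 0..t (int N)}"
proof -
  have "t 0 \<le> t (int N)"
    by (rule monoD[OF assms(1)]) simp
  consider "k < 0" | "0 \<le> k" "k \<le> int N" | "int N < k"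
    by linarith
  then show ?thesis
    using assms \<open>t 0 \<le> t (int N)\<close>
    by cases (auto simp: clamped_knots_eq intro: monoD[OF assms(1)])
qed

lemma knots_on_mesh_clamped:
  assumes "is_mesh cl a b \<gamma> n z" "mesh_knots cl a b n z p mlt N t" "a < b"
  shows "knots_on_mesh \<gamma> n z (clamped_knots p N t) (- int p) (int N + int p)"
  unfolding knots_on_mesh_def
proof (intro ballI impI)
  let ?t = "clamped_knots p N t"
  fix s assume s: "s \<in> {- int p<..int N + int p}" and lt: "?t (s - 1) < ?t s"
  have range: "s \<in> {1..int N}"
  proof (rule ccontr)
    assume "s \<notin> {1..int N}"
    then consider "s \<le> 0" | "int N < s"
      by fastforce
    then have "?t (s - 1) = ?t s"
      using s by cases (auto simp: clamped_knots_eq)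
    with lt show False by simp
  qed
  then have eq: "?t (s - 1) = t (s - 1)" "?t s = t s"
    by (auto simp: clamped_knots_eq)
  obtain j where "j \<in> {1..n}" "t (s - 1) = z (j - 1)" "t s = z j"
    using knot_span_element[OF assms range] lt eq by auto
  then show "mesh_span \<gamma> n z (?t (s - 1)) (?t s)"
    unfolding mesh_span_def eq by (intro bexI[of _ j] exI[of _ 0]) auto
qed

text \<open>The knots equal to an end point form an initial or a final section of \<open>t\<^sub>0, \<dots>, t\<^sub>N\<close> of length \<open>p + 1\<close>.\<close>

lemma open_knot_multiplicities:
  assumes "is_mesh False a b \<gamma> n z" "mesh_knots False a b n z p mlt N t" "a < b"
  shows "t (int p) = a" "t (int N - int p) = b"
proof -
  note ends = mesh_knots_endpoints[OF assms]
  have mono: "mono t"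
    using assms(2) by (simp add: mesh_knots_def knot_sequence_def)
  have z: "z 0 = a" "z n = b" "a \<in> nodes False n z" "b \<in> nodes False n z"
    using assms(1) by (auto simp: is_mesh_def nodes_def image_iff intro: bexI[of _ 0] bexI[of _ n])
  then have card: "card {i\<in>{0..int N}. t i = a} = p + 1" "card {i\<in>{0..int N}. t i = b} = p + 1"
    using assms(2) by (auto simp: mesh_knots_def)
  show "t (int p) = a"
  proof (rule ccontr)
    assume "t (int p) \<noteq> a"
    then have "a < t (int p)"
      using monoD[OF mono, of 0 "int p"] ends(2) by simp
    then have "i < int p" if "t i = a" for i
      using that by (intro mono_index_less[OF mono]) simp
    then have "{i\<in>{0..int N}. t i = a} \<subseteq> {0..<int p}"
      by auto
    then have "card {i\<in>{0..int N}. t i = a} \<le> card {0..<int p}"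
      by (rule card_mono[rotated]) simp
    with card(1) show False by simp
  qed
  show "t (int N - int p) = b"
  proof (rule ccontr)
    assume "t (int N - int p) \<noteq> b"
    then have "t (int N - int p) < b"
      using monoD[OF mono, of "int N - int p" "int N"] ends(3) by simp
    then have "int N - int p < i" if "t i = b" for i
      using that by (intro mono_index_less[OF mono]) simp
    then have "{i\<in>{0..int N}. t i = b} \<subseteq> {int N - int p<..int N}"
      by auto
    then have "card {i\<in>{0..int N}. t i = b} \<le> card {int N - int p<..int N}"
      by (rule card_mono[rotated]) simp
    with card(2) show False by simp
  qed
qed

section \<open>Speed and arclength\<close>

text \<open>At the left end point of a piece the one-sided derivative of that piece is still the right
  derivative, so half-open pieces cover every break point except \<open>b\<close>.\<close>

lemma right_deriv_continuous_on_pieces: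
  assumes "piecewise_C2_path a b \<gamma>"
  obtains P :: "(real \<times> real) set" where "finite P" "{a..<b} = (\<Union>(c, d)\<in>P. {c..<d})"
    "\<And>c d. (c, d) \<in> P \<Longrightarrow> \<exists>f. continuous_on {c..d} f \<and> (\<forall>s\<in>{c..<d}. right_deriv \<gamma> s = f s)"
proof -
  obtain S where S: "finite S" "{a, b} \<subseteq> S" "S \<subseteq> {a..b}"
    and pieces: "\<forall>c\<in>S. \<forall>d\<in>S. c < d \<and> S \<inter> {c<..<d} = {} \<longrightarrow>
       (\<exists>\<gamma>1 \<gamma>2. (\<forall>s\<in>{c..d}. (\<gamma> has_vector_derivative \<gamma>1 s) (at s within {c..d})) \<and>
               (\<forall>s\<in>{c..d}. (\<gamma>1 has_vector_derivative \<gamma>2 s) (at s within {c..d})) \<and>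
               continuous_on {c..d} \<gamma>2)"
    using assms unfolding piecewise_C2_path_def by (elim conjE exE) (rule that)
  let ?P = "{(c, d)\<in>S \<times> S. c < d \<and> S \<inter> {c<..<d} = {}}"
  have "finite ?P"
    using S(1) by (auto intro: finite_subset[of _ "S \<times> S"])
  moreover have "{a..<b} = (\<Union>(c, d)\<in>?P. {c..<d})"
  proof
    show "(\<Union>(c, d)\<in>?P. {c..<d}) \<subseteq> {a..<b}"
    proof
      fix s assume "s \<in> (\<Union>(c, d)\<in>?P. {c..<d})"
      then obtain c d where "c \<in> S" "d \<in> S" "s \<in> {c..<d}"
        by blast
      then have "c \<in> {a..b}" "d \<in> {a..b}"
        using S(3) by blast+
      then show "s \<in> {a..<b}"
        using \<open>s \<in> {c..<d}\<close> by auto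
    qed
    show "{a..<b} \<subseteq> (\<Union>(c, d)\<in>?P. {c..<d})"
    proof
      fix s assume s: "s \<in> {a..<b}"
      define L where "L = {x\<in>S. x \<le> s}"
      define U where "U = {x\<in>S. s < x}"
      have fin: "finite L" "finite U"
        using S(1) by (auto simp: L_def U_def)
      have "a \<in> L" "b \<in> U"
        using S(2) s by (auto simp: L_def U_def)
      then have "L \<noteq> {}" "U \<noteq> {}"
        by blast+
      then have "Max L \<in> L" "Min U \<in> U"
        by (simp_all add: fin)
      then have consec: "Max L \<in> S" "Max L \<le> s" "Min U \<in> S" "s < Min U"
        by (simp_all add: L_def U_def)
      have "x \<notin> {Max L<..<Min U}" if "x \<in> S" for x
        using that Max_ge[OF fin(1), of x] Min_le[OF fin(2), of x] by (cases "x \<le> s") (auto simp: L_def U_def)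
      then have "(Max L, Min U) \<in> ?P"
        using consec by auto
      then show "s \<in> (\<Union>(c, d)\<in>?P. {c..<d})"
        using consec by (intro UN_I[of "(Max L, Min U)"]) auto
    qed
  qed
  moreover have "\<exists>f. continuous_on {c..d} f \<and> (\<forall>s\<in>{c..<d}. right_deriv \<gamma> s = f s)"
    if "(c, d) \<in> ?P" for c d
  proof -
    have "c \<in> S" "d \<in> S" "c < d \<and> S \<inter> {c<..<d} = {}"
      using \<open>(c, d) \<in> ?P\<close> by auto
    from pieces[rule_format, OF this]
    obtain \<gamma>1 \<gamma>2 where d1: "\<forall>s\<in>{c..d}. (\<gamma> has_vector_derivative \<gamma>1 s) (at s within {c..d})"
      and d2: "\<forall>s\<in>{c..d}. (\<gamma>1 has_vector_derivative \<gamma>2 s) (at s within {c..d})"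
      by blast
    have "continuous_on {c..d} \<gamma>1"
      by (rule continuous_on_vector_derivative) (use d2 in blast)
    moreover have "right_deriv \<gamma> s = \<gamma>1 s" if s: "s \<in> {c..<d}" for s
    proof -
      have "(\<gamma> has_vector_derivative \<gamma>1 s) (at s within {s..d})"
        by (rule has_vector_derivative_within_subset[OF d1[rule_format, of s]]) (use s in auto)
      then have "(\<gamma> has_vector_derivative \<gamma>1 s) (at_right s)"
        using s by (simp add: at_within_Icc_at_right)
      then show ?thesis
        unfolding right_deriv_def by (intro vector_derivative_within) auto
    qed
    ultimately show ?thesis by blast
  qed
  ultimately show ?thesis
    by (rule that)
qed

lemma speed_regular:
  assumes "piecewise_C2_path a b \<gamma>"
  shows "(\<lambda>s. speed cl b \<gamma> s * indicator {a..b} s) \<in> borel_measurable borel"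
    and "\<exists>B. \<forall>s\<in>{a..b}. speed cl b \<gamma> s \<le> B"
proof -
  obtain P where P: "finite P" "{a..<b} = (\<Union>(c, d)\<in>P. {c..<d})"
    and cont: "\<And>c d. (c, d) \<in> P \<Longrightarrow>
      \<exists>f. continuous_on {c..d} f \<and> (\<forall>s\<in>{c..<d}. right_deriv \<gamma> s = f s)"
    using right_deriv_continuous_on_pieces[OF assms] by blast
  let ?h = "\<lambda>s. norm (right_deriv \<gamma> s) * indicator {a..<b} s :: real"
  have piece: "?h \<in> borel_measurable (restrict_space borel {c..<d})"
    "\<exists>B. \<forall>s\<in>{c..<d}. norm (right_deriv \<gamma> s) \<le> B" if cd: "(c, d) \<in> P" for c d
  proof -
    obtain f where f: "continuous_on {c..d} f" "\<And>s. s \<in> {c..<d} \<Longrightarrow> right_deriv \<gamma> s = f s"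
      using cont[OF cd] by blast
    have in_ab: "s \<in> {a..<b}" if "s \<in> {c..<d}" for s
      unfolding P(2) using that cd by blast
    have "continuous_on {c..<d} (\<lambda>s. norm (f s))"
      by (intro continuous_on_norm continuous_on_subset[OF f(1)]) auto
    then have "(\<lambda>s. norm (f s)) \<in> borel_measurable (restrict_space borel {c..<d})"
      by (rule borel_measurable_continuous_on_restrict)
    then show "?h \<in> borel_measurable (restrict_space borel {c..<d})"
      by (rule measurable_cong[THEN iffD1, rotated]) (use f(2) in_ab in \<open>auto simp: space_restrict_space\<close>)
    have "bounded (f ` {c..d})"
      by (intro compact_imp_bounded compact_continuous_image f) simp
    then obtain B where "\<forall>x\<in>f ` {c..d}. norm x \<le> B"
      unfolding bounded_iff by blast
    then show "\<exists>B. \<forall>s\<in>{c..<d}. norm (right_deriv \<gamma> s) \<le> B"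
      using f(2) by (intro exI[of _ B]) auto
  qed
  have h: "?h \<in> borel_measurable borel"
  proof (rule measurable_piecewise_restrict[where C = "insert (- {a..<b}) ((\<lambda>(c, d). {c..<d}) ` P)"])
    show "countable (insert (- {a..<b}) ((\<lambda>(c, d). {c..<d}) ` P))"
      using P(1) by (intro countable_insert countable_finite) simp
    show "space borel \<subseteq> \<Union> (insert (- {a..<b}) ((\<lambda>(c, d). {c..<d}) ` P))"
      using P(2) by auto
    fix A assume A: "A \<in> insert (- {a..<b}) ((\<lambda>(c, d). {c..<d}) ` P)"
    then show "A \<inter> space borel \<in> sets borel"
      by auto
    show "?h \<in> borel_measurable (restrict_space borel A)"
    proof (cases "A = - {a..<b}")
      case True
      have "(\<lambda>s. 0 :: real) \<in> borel_measurable (restrict_space borel A)"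
        by simp
      then show ?thesis
        by (rule measurable_cong[THEN iffD1, rotated])
          (use True in \<open>auto simp: space_restrict_space\<close>)
    next
      case False
      then show ?thesis
        using A piece(1) by auto
    qed
  qed
  have "(\<lambda>s. speed cl b \<gamma> s * indicator {a..b} s) =
      (\<lambda>s. ?h s + speed cl b \<gamma> b * indicator ({a..b} \<inter> {b}) s)"
    by (auto simp: fun_eq_iff speed_def indicator_def)
  also have "\<dots> \<in> borel_measurable borel"
    by (intro borel_measurable_add[OF h] borel_measurable_times borel_measurable_const
        borel_measurable_indicator) simp
  finally show "(\<lambda>s. speed cl b \<gamma> s * indicator {a..b} s) \<in> borel_measurable borel" .
  obtain B where B: "\<And>c d s. (c, d) \<in> P \<Longrightarrow> s \<in> {c..<d} \<Longrightarrow> norm (right_deriv \<gamma> s) \<le> B (c, d)"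
    using piece(2) by (metis case_prod_conv surj_pair)
  have "speed cl b \<gamma> s \<le> max (speed cl b \<gamma> b) (Max (insert 0 (B ` P)))" if s: "s \<in> {a..b}" for s
  proof (cases "s = b")
    case False
    then have "s \<in> {a..<b}"
      using s by auto
    then obtain c d where cd: "(c, d) \<in> P" "s \<in> {c..<d}"
      unfolding P(2) by blast
    have "B (c, d) \<le> Max (insert 0 (B ` P))"
      using P(1) cd(1) by (intro Max_ge) auto
    then show ?thesis
      using B[OF cd] False by (auto simp: speed_def)
  qed simp
  then show "\<exists>B. \<forall>s\<in>{a..b}. speed cl b \<gamma> s \<le> B"
    by blast
qed

lemma speed_nonneg: "0 \<le> speed cl b \<gamma> s"
  by (simp add: speed_def)

lemma has_right_derivative_translate:
  fixes \<gamma> :: "real \<Rightarrow> real^2"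
  assumes "\<forall>x. \<gamma> (x + c) = \<gamma> x" "(\<gamma> has_vector_derivative v) (at_right (s + c))"
  shows "(\<gamma> has_vector_derivative v) (at_right s)"
proof -
  have "(\<lambda>x. x + c) ` {s<..} = {s + c<..}"
    by (auto simp: image_iff intro!: bexI[of _ "_ - c"])
  then have "(\<gamma> has_vector_derivative v) (at ((\<lambda>x. x + c) s) within (\<lambda>x. x + c) ` {s<..})"
    using assms(2) by simp
  then have "((\<gamma> \<circ> (\<lambda>x. x + c)) has_vector_derivative 1 *\<^sub>R v) (at_right s)"
    by (intro vector_diff_chain_within) (auto intro!: derivative_eq_intros)
  moreover have "\<gamma> \<circ> (\<lambda>x. x + c) = \<gamma>"
    using assms(1) by (simp add: fun_eq_iff)
  ultimately show ?thesis by simp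
qed

text \<open>The derivative of a path is selected by a choice operator, so it suffices that the same vectors
  qualify at both points.\<close>

lemma speed_periodic:
  assumes "\<forall>x. \<gamma> (x + c) = \<gamma> x"
  shows "speed True b \<gamma> (s + c) = speed True b \<gamma> s"
proof -
  have "\<forall>x. \<gamma> (x + (- c)) = \<gamma> x"
    using assms by (metis add.right_neutral add.assoc add.left_inverse)
  then have "(\<gamma> has_vector_derivative v) (at_right (s + c)) \<longleftrightarrow>
      (\<gamma> has_vector_derivative v) (at_right s)" for v
    using has_right_derivative_translate[OF assms, of v s]
      has_right_derivative_translate[of \<gamma> "- c" v "s + c"] by auto
  then show ?thesis
    by (simp add: speed_def right_deriv_def vector_derivative_def)
qed

lemma speed_integrable:
  assumes "piecewise_C2_path a b \<gamma>"
  shows "set_integrable lborel {a..b} (speed cl b \<gamma>)"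
proof -
  obtain B where B: "\<And>s. s \<in> {a..b} \<Longrightarrow> speed cl b \<gamma> s \<le> B"
    using speed_regular(2)[OF assms, of cl] by blast
  have "set_integrable lborel {a..b} (\<lambda>s. B)"
    unfolding set_integrable_def
    by (intro integrable_scaleR_left integrable_real_indicator) (simp_all add: emeasure_lborel_Icc_eq)
  then show ?thesis
    unfolding set_integrable_def
    by (rule Bochner_Integration.integrable_bound)
      (use speed_regular(1)[OF assms, of cl] B in
        \<open>auto simp: mult.commute indicator_def speed_nonneg intro!: AE_I2 intro: order.trans[OF _ abs_ge_self]\<close>)
qed

lemma sets_arclength [measurable_cong]:
  "sets (arclength cl a b \<gamma>) = sets (restrict_space borel (\<gamma> ` {a..b}))"
  by (simp add: arclength_def)

lemma space_arclength [simp]: "space (arclength cl a b \<gamma>) = \<gamma> ` {a..b}"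
  by (simp add: arclength_def space_restrict_space)

lemma parametrization_measurable:
  fixes \<gamma> :: "real \<Rightarrow> real^2"
  assumes "continuous_on {a..b} \<gamma>"
  shows "\<gamma> \<in> measurable (restrict_space lborel {a..b}) (restrict_space borel (\<gamma> ` {a..b}))"
proof (rule measurable_restrict_space2)
  show "\<gamma> \<in> space (restrict_space lborel {a..b}) \<rightarrow> \<gamma> ` {a..b}"
    by (auto simp: space_restrict_space)
  have "\<gamma> \<in> borel_measurable (restrict_space borel {a..b})"
    by (rule borel_measurable_continuous_on_restrict[OF assms])
  then show "\<gamma> \<in> borel_measurable (restrict_space lborel {a..b})"
    by (simp cong: measurable_cong_sets add: sets_restrict_space)
qed

lemma speed_measurable:
  assumes "piecewise_C2_path a b \<gamma>"
  shows "speed cl b \<gamma> \<in> borel_measurable (restrict_space lborel {a..b})"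
  using speed_regular(1)[OF assms, of cl]
  by (subst borel_measurable_restrict_space_iff) (simp_all add: mult.commute)

lemma arclength_integral:
  assumes "piecewise_C2_path a b \<gamma>"
    and F: "F \<in> borel_measurable (arclength cl a b \<gamma>)"
  shows "(LINT x|arclength cl a b \<gamma>. F x) = (LINT s:{a..b}|lborel. F (\<gamma> s) * speed cl b \<gamma> s)"
    and "integrable (arclength cl a b \<gamma>) F \<Longrightarrow>
      set_integrable lborel {a..b} (\<lambda>s. F (\<gamma> s) * speed cl b \<gamma> s)"
proof -
  have "continuous_on {a..b} \<gamma>"
    using assms(1) by (simp add: piecewise_C2_path_def)
  let ?R = "restrict_space lborel {a..b}"
  let ?D = "density ?R (\<lambda>s. ennreal (speed cl b \<gamma> s))"
  note \<gamma> = parametrization_measurable[OF \<open>continuous_on {a..b} \<gamma>\<close>]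
  then have \<gamma>': "\<gamma> \<in> measurable ?D (restrict_space borel (\<gamma> ` {a..b}))"
    by simp
  have F': "F \<in> borel_measurable (restrict_space borel (\<gamma> ` {a..b}))"
    using F by (simp cong: measurable_cong_sets add: sets_arclength)
  have F\<gamma>: "(\<lambda>s. F (\<gamma> s)) \<in> borel_measurable ?R"
    using \<gamma> F' by (rule measurable_compose)
  note sp = speed_measurable[OF assms(1), of cl]
  have "(LINT x|arclength cl a b \<gamma>. F x) = (LINT s|?D. F (\<gamma> s))"
    unfolding arclength_def by (rule integral_distr[OF \<gamma>' F'])
  also have "\<dots> = (LINT s|?R. speed cl b \<gamma> s *\<^sub>R F (\<gamma> s))"
    by (rule integral_density) (use F\<gamma> sp in \<open>auto simp: speed_nonneg\<close>)
  also have "\<dots> = (LINT s:{a..b}|lborel. F (\<gamma> s) * speed cl b \<gamma> s)"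
    by (subst integral_restrict_space) (simp_all add: set_lebesgue_integral_def mult.commute)
  finally show "(LINT x|arclength cl a b \<gamma>. F x) = (LINT s:{a..b}|lborel. F (\<gamma> s) * speed cl b \<gamma> s)" .
  assume "integrable (arclength cl a b \<gamma>) F"
  then have "integrable ?D (\<lambda>s. F (\<gamma> s))"
    unfolding arclength_def by (subst (asm) integrable_distr_eq[OF \<gamma>' F'])
  then have "integrable ?R (\<lambda>s. speed cl b \<gamma> s *\<^sub>R F (\<gamma> s))"
    by (subst (asm) integrable_density) (use F\<gamma> sp in \<open>auto simp: speed_nonneg\<close>)
  then show "set_integrable lborel {a..b} (\<lambda>s. F (\<gamma> s) * speed cl b \<gamma> s)"
    by (subst (asm) integrable_restrict_space) (simp_all add: set_integrable_def mult.commute)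
qed

lemma finite_measure_arclength:
  assumes "piecewise_C2_path a b \<gamma>"
  shows "finite_measure (arclength cl a b \<gamma>)"
proof
  have "continuous_on {a..b} \<gamma>"
    using assms by (simp add: piecewise_C2_path_def)
  let ?R = "restrict_space lborel {a..b}"
  let ?D = "density ?R (\<lambda>s. ennreal (speed cl b \<gamma> s))"
  have \<gamma>: "\<gamma> \<in> measurable ?D (restrict_space borel (\<gamma> ` {a..b}))"
    using parametrization_measurable[OF \<open>continuous_on {a..b} \<gamma>\<close>] by simp
  obtain B where B: "\<And>s. s \<in> {a..b} \<Longrightarrow> speed cl b \<gamma> s \<le> B"
    using speed_regular(2)[OF assms, of cl] by blast
  have "emeasure (arclength cl a b \<gamma>) (space (arclength cl a b \<gamma>)) \<le> emeasure ?D (space ?D)"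
    unfolding arclength_def
    by (subst emeasure_distr[OF \<gamma>]) (simp, rule emeasure_space)
  also have "\<dots> = (\<integral>\<^sup>+ s. ennreal (speed cl b \<gamma> s) * indicator (space ?R) s \<partial>?R)"
    using sets.top[of ?R] speed_measurable[OF assms, of cl] by (subst emeasure_density) simp_all
  also have "\<dots> \<le> (\<integral>\<^sup>+ s. ennreal B \<partial>?R)"
    by (intro nn_integral_mono) (auto simp: space_restrict_space indicator_def intro!: ennreal_leI B)
  also have "\<dots> = ennreal B * emeasure lborel {a..b}"
    by (simp add: space_restrict_space emeasure_restrict_space)
  also have "\<dots> < \<infinity>"
    by (simp add: ennreal_mult_less_top emeasure_lborel_Icc_eq)
  finally show "emeasure (arclength cl a b \<gamma>) (space (arclength cl a b \<gamma>)) \<noteq> \<infinity>"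
    by simp
qed

definition param_domain :: "bool \<Rightarrow> real \<Rightarrow> real \<Rightarrow> real set" where
  "param_domain cl a b = (if cl then {a..<b} else {a..b})"

text \<open>The inverse need not be continuous on a closed curve, but the points with parameter at most
  \<open>c < b\<close> form the compact set \<open>\<gamma>[a, c]\<close>.\<close>

lemma inverse_parametrization_measurable:
  fixes \<gamma> :: "real \<Rightarrow> real^2"
  assumes "continuous_on {a..b} \<gamma>" "bij_betw \<gamma> (param_domain cl a b) (\<gamma> ` {a..b})"
  shows "inv_into (param_domain cl a b) \<gamma> \<in> borel_measurable (restrict_space borel (\<gamma> ` {a..b}))"
proof (rule borel_measurable_iff_le[THEN iffD2], rule allI)
  fix c :: real
  let ?D = "param_domain cl a b"
  let ?M = "restrict_space borel (\<gamma> ` {a..b})"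
  have inv: "inv_into ?D \<gamma> x \<in> ?D" "\<gamma> (inv_into ?D \<gamma> x) = x" if "x \<in> \<gamma> ` {a..b}" for x
    using that assms(2) by (metis bij_betw_imp_surj_on inv_into_into, metis bij_betw_inv_into_right)
  have inv_eq: "inv_into ?D \<gamma> (\<gamma> y) = y" if "y \<in> ?D" for y
    using that assms(2) by (metis bij_betw_inv_into_left)
  have compact: "compact (\<gamma> ` {a..d})" if "d \<le> b" for d
    using that by (intro compact_continuous_image continuous_on_subset[OF assms(1)]) auto
  show "{x \<in> space ?M. inv_into ?D \<gamma> x \<le> c} \<in> sets ?M"
  proof (cases "c < b")
    case True
    have "{x \<in> space ?M. inv_into ?D \<gamma> x \<le> c} = \<gamma> ` {a..c}"
    proof
      show "{x \<in> space ?M. inv_into ?D \<gamma> x \<le> c} \<subseteq> \<gamma> ` {a..c}"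
      proof
        fix x assume "x \<in> {x \<in> space ?M. inv_into ?D \<gamma> x \<le> c}"
        then have x: "x \<in> \<gamma> ` {a..b}" "inv_into ?D \<gamma> x \<le> c"
          by (auto simp: space_restrict_space)
        then show "x \<in> \<gamma> ` {a..c}"
          using inv[OF x(1)] by (intro image_eqI[of _ _ "inv_into ?D \<gamma> x"]) (auto simp: param_domain_def split: if_splits)
      qed
      show "\<gamma> ` {a..c} \<subseteq> {x \<in> space ?M. inv_into ?D \<gamma> x \<le> c}"
        using True inv_eq by (auto simp: space_restrict_space param_domain_def)
    qed
    moreover have "\<gamma> ` {a..c} \<in> sets ?M"
    proof -
      have "\<gamma> ` {a..c} = \<gamma> ` {a..b} \<inter> \<gamma> ` {a..c}"
        using True by auto
      then show ?thesis
        unfolding sets_restrict_space using borel_compact[OF compact[OF less_imp_le[OF True]]]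
        by (intro image_eqI[where f = "(\<inter>) (\<gamma> ` {a..b})"]) auto
    qed
    ultimately show ?thesis by simp
  next
    case False
    then have "{x \<in> space ?M. inv_into ?D \<gamma> x \<le> c} = space ?M"
      using inv(1) by (force simp: space_restrict_space param_domain_def split: if_splits)
    then show ?thesis by simp
  qed
qed

section \<open>From knot intervals to the curve\<close>

lemma lint_translate:
  fixes F :: "real \<Rightarrow> real"
  shows "(LINT x:{u + c..v + c}|lborel. F x) = (LINT x:{u..v}|lborel. F (x + c))"
proof -
  have "(LINT x:{u + c..v + c}|lborel. F x) =
      (LINT x|lborel. indicator {u + c..v + c} (c + 1 * x) *\<^sub>R F (c + 1 * x))"
    unfolding set_lebesgue_integral_def by (subst lborel_integral_real_affine[of 1 _ c]) simp_all
  also have "\<dots> = (LINT x:{u..v}|lborel. F (x + c))"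
    unfolding set_lebesgue_integral_def
    by (rule Bochner_Integration.integral_cong) (auto simp: indicator_def add.commute)
  finally show ?thesis .
qed

lemma integral_nonneg_by_spans:
  fixes h :: "real \<Rightarrow> real" and t :: "int \<Rightarrow> real"
  assumes "mono t" "set_integrable lborel {t 0..t (int N)} h"
    and "\<And>s. s \<in> {1..int N} \<Longrightarrow> 0 \<le> (LINT x:{t (s - 1)..t s}|lborel. h x)"
  shows "0 \<le> (LINT x:{t 0..t (int N)}|lborel. h x)"
proof -
  have sub: "set_integrable lborel {t i..t j} h" if "0 \<le> i" "j \<le> int N" for i j
    by (rule set_integrable_subset[OF assms(2)]) (use that in \<open>auto intro: order.trans monoD[OF assms(1)]\<close>)
  have "0 \<le> integral {t 0..t (int k)} h" if "k \<le> N" for k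
    using that
  proof (induction k)
    case 0
    then show ?case by simp
  next
    case (Suc k)
    have "integral {t 0..t (int k)} h + integral {t (int k)..t (int (Suc k))} h =
        integral {t 0..t (int (Suc k))} h"
    proof (rule Henstock_Kurzweil_Integration.integral_combine)
      show "h integrable_on {t 0..t (int (Suc k))}"
        using sub[of 0 "int (Suc k)"] Suc.prems by (auto dest: set_borel_integral_eq_integral(1))
    qed (auto intro: monoD[OF assms(1)])
    moreover have "0 \<le> integral {t (int k)..t (int (Suc k))} h"
      using assms(3)[of "int (Suc k)"] sub[of "int k" "int (Suc k)"] Suc.prems
      by (simp add: set_borel_integral_eq_integral(2))
    ultimately show ?case
      using Suc by simp
  qed
  then show ?thesis
    using assms(2) by (simp add: set_borel_integral_eq_integral(2))
qed

text \<open>The function \<open>R\<close> stands for a single NURBS below \<open>\<psi>\<close>, and \<open>c\<close> for the multiple of the period that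
  moves the knot interval into the support of \<open>R\<close>. The claim says that the integral of
  \<open>(1 - q) - (1 - \<psi>)\<^sup>2\<close> over \<open>Z\<close> is nonnegative, and this can be checked on one knot interval at a time.\<close>

lemma arclength_defect_le:
  fixes \<gamma> :: "real \<Rightarrow> real^2" and t :: "int \<Rightarrow> real" and a b :: real and cl :: bool
  defines "\<mu> \<equiv> arclength cl a b \<gamma>"
  assumes pc: "piecewise_C2_path a b \<gamma>"
    and t: "mono t" "t 0 = a" "t (int N) = b"
    and Z: "Z \<in> sets \<mu>" and \<psi>: "\<psi> \<in> borel_measurable \<mu>" "\<forall>x\<in>\<gamma> ` {a..b}. 0 \<le> \<psi> x \<and> \<psi> x \<le> 1"
    and spans: "\<And>s. s \<in> {1..int N} \<Longrightarrow> t (s - 1) < t s \<Longrightarrow>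
      (\<forall>x\<in>{t (s - 1)<..<t s}. \<gamma> x \<notin> Z) \<or>
      (\<exists>c R. R \<in> borel_measurable borel \<and>
        (\<forall>x\<in>{t (s - 1)..t s}. \<gamma> x \<in> Z \<and> 0 \<le> R (x + c) \<and> R (x + c) \<le> \<psi> (\<gamma> x) \<and>
            speed cl b \<gamma> (x + c) = speed cl b \<gamma> x) \<and>
        (LINT x:{t (s - 1) + c..t s + c}|lborel. \<bar>(1 - R x) * speed cl b \<gamma> x\<bar>)
          \<le> (1 - q) * (LINT x:{t (s - 1) + c..t s + c}|lborel. \<bar>speed cl b \<gamma> x\<bar>))"
  shows "(LINT x:Z|\<mu>. (1 - \<psi> x)\<^sup>2) \<le> (1 - q) * measure \<mu> Z"
proof -
  let ?\<phi> = "speed cl b \<gamma>"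
  note [measurable] = \<psi>(1) Z
  interpret finite_measure \<mu>
    unfolding \<mu>_def by (rule finite_measure_arclength[OF pc])
  have space: "space \<mu> = \<gamma> ` {a..b}"
    by (simp add: \<mu>_def)
  define H where "H x = indicator Z x * ((1 - q) - (1 - \<psi> x)\<^sup>2)" for x
  have H_meas: "H \<in> borel_measurable \<mu>"
    unfolding H_def by measurable
  \<comment> \<open>Measurable functions bounded on \<open>\<Gamma>\<close> are integrable, as the curve has finite length.\<close>
  have sq: "(1 - \<psi> x)\<^sup>2 \<le> 1" if "x \<in> \<gamma> ` {a..b}" for x
    using \<psi>(2) that by (intro power_le_one) auto
  have int_sq: "integrable \<mu> (\<lambda>x. indicator Z x * (1 - \<psi> x)\<^sup>2)"
    by (rule integrable_const_bound[of _ 1])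
      (use sq in \<open>auto simp: space indicator_def intro!: AE_I2\<close>)
  have int_ind: "integrable \<mu> (\<lambda>x. indicator Z x * (1 - q))"
    by (rule integrable_const_bound[of _ "\<bar>1 - q\<bar>"]) (auto simp: indicator_def)
  have H_eq: "H x = indicator Z x * (1 - q) - indicator Z x * (1 - \<psi> x)\<^sup>2" for x
    by (simp add: H_def algebra_simps)
  have H_int: "integrable \<mu> H"
    unfolding H_eq[abs_def] using int_ind int_sq by (rule Bochner_Integration.integrable_diff)
  have H_lint: "(LINT x|\<mu>. H x) = (1 - q) * measure \<mu> Z - (LINT x:Z|\<mu>. (1 - \<psi> x)\<^sup>2)"
    unfolding H_eq[abs_def]
    using int_ind int_sq sets.sets_into_space[OF Z]
    by (subst Bochner_Integration.integral_diff) (simp_all add: set_lebesgue_integral_def Int_absorb2)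
  let ?h = "\<lambda>s. H (\<gamma> s) * ?\<phi> s"
  have h_int: "set_integrable lborel {a..b} ?h"
    using arclength_integral(2)[OF pc, of H cl] H_meas H_int by (simp add: \<mu>_def)
  have \<phi>_int: "set_integrable lborel {a..b} ?\<phi>"
    by (rule speed_integrable[OF pc])
  have "0 \<le> (LINT x:{t 0..t (int N)}|lborel. ?h x)"
  proof (rule integral_nonneg_by_spans[OF t(1)])
    show "set_integrable lborel {t 0..t (int N)} ?h"
      using h_int t by simp
    fix s assume s: "s \<in> {1..int N}"
    let ?I = "{t (s - 1)..t s}"
    have "a \<le> t (s - 1)" "t s \<le> b"
      unfolding t(2,3)[symmetric] using s by (auto intro!: monoD[OF t(1)])
    then have I_sub: "?I \<subseteq> {a..b}"
      by auto
    consider "t s \<le> t (s - 1)" | "t (s - 1) < t s" "\<forall>x\<in>{t (s - 1)<..<t s}. \<gamma> x \<notin> Z"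
      | c R where "R \<in> borel_measurable borel" "t (s - 1) < t s"
        "\<forall>x\<in>?I. \<gamma> x \<in> Z \<and> 0 \<le> R (x + c) \<and> R (x + c) \<le> \<psi> (\<gamma> x) \<and> ?\<phi> (x + c) = ?\<phi> x"
        "(LINT x:{t (s - 1) + c..t s + c}|lborel. \<bar>(1 - R x) * ?\<phi> x\<bar>)
          \<le> (1 - q) * (LINT x:{t (s - 1) + c..t s + c}|lborel. \<bar>?\<phi> x\<bar>)"
    proof (cases "t (s - 1) < t s")
      case True
      from spans[OF s True] show ?thesis
        using True by (elim disjE exE conjE) (rule that(2), assumption+, rule that(3), assumption+)
    qed (use that(1) in simp)
    then show "0 \<le> (LINT x:?I|lborel. ?h x)"
    proof cases
      case 1
      have "AE x in lborel. indicator ?I x *\<^sub>R ?h x = 0"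
        using AE_lborel_singleton[of "t s"] by eventually_elim (use 1 in auto)
      then show ?thesis
        unfolding set_lebesgue_integral_def by (simp add: integral_eq_zero_AE)
    next
      case 2
      have "AE x in lborel. indicator ?I x *\<^sub>R ?h x = 0"
        using AE_lborel_singleton[of "t s"] AE_lborel_singleton[of "t (s - 1)"]
        by eventually_elim (use 2 in \<open>auto simp: indicator_def H_def\<close>)
      then show ?thesis
        unfolding set_lebesgue_integral_def by (simp add: integral_eq_zero_AE)
    next
      case (3 c R)
      note [measurable] = 3(1)
      have I_\<phi>: "set_integrable lborel ?I ?\<phi>"
        by (rule set_integrable_subset[OF \<phi>_int]) (use I_sub in auto)
      have R_le: "\<bar>1 - R (x + c)\<bar> \<le> 1" if "x \<in> ?I" for x
      proof -
        have "\<psi> (\<gamma> x) \<le> 1"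
          using \<psi>(2) that I_sub by blast
        then show ?thesis
          using 3(3) that by force
      qed
      have I_R: "set_integrable lborel ?I (\<lambda>x. \<bar>1 - R (x + c)\<bar> * ?\<phi> x)"
        using I_\<phi> unfolding set_integrable_def
      proof (rule Bochner_Integration.integrable_bound)
        have "(\<lambda>x. \<bar>1 - R (x + c)\<bar> * (indicator ?I x *\<^sub>R ?\<phi> x)) \<in> borel_measurable lborel"
          using borel_measurable_integrable[OF I_\<phi>[unfolded set_integrable_def]] by measurable
        then show "(\<lambda>x. indicator ?I x *\<^sub>R (\<bar>1 - R (x + c)\<bar> * ?\<phi> x)) \<in> borel_measurable lborel"
          by (simp add: mult.left_commute)
        show "AE x in lborel. norm (indicator ?I x *\<^sub>R (\<bar>1 - R (x + c)\<bar> * ?\<phi> x))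
            \<le> norm (indicator ?I x *\<^sub>R ?\<phi> x)"
          by (rule AE_I2) (use R_le in \<open>auto simp: indicator_def abs_mult speed_nonneg mult_left_le_one_le\<close>)
      qed
      have "0 \<le> (1 - q) * (LINT x:?I|lborel. \<bar>?\<phi> (x + c)\<bar>)
          - (LINT x:?I|lborel. \<bar>(1 - R (x + c)) * ?\<phi> (x + c)\<bar>)"
        using 3(4) by (simp add: lint_translate)
      also have "(LINT x:?I|lborel. \<bar>?\<phi> (x + c)\<bar>) = (LINT x:?I|lborel. ?\<phi> x)"
        by (rule set_lebesgue_integral_cong) (use 3(3) in \<open>auto simp: speed_nonneg\<close>)
      also have "(LINT x:?I|lborel. \<bar>(1 - R (x + c)) * ?\<phi> (x + c)\<bar>)
          = (LINT x:?I|lborel. \<bar>1 - R (x + c)\<bar> * ?\<phi> x)"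
        by (rule set_lebesgue_integral_cong) (use 3(3) in \<open>auto simp: speed_nonneg abs_mult\<close>)
      also have "(1 - q) * (LINT x:?I|lborel. ?\<phi> x) - \<dots> =
          (LINT x:?I|lborel. (1 - q) * ?\<phi> x - \<bar>1 - R (x + c)\<bar> * ?\<phi> x)"
        using I_\<phi> I_R by simp
      also have "\<dots> \<le> (LINT x:?I|lborel. ?h x)"
      proof (rule set_integral_mono)
        show "set_integrable lborel ?I (\<lambda>x. (1 - q) * ?\<phi> x - \<bar>1 - R (x + c)\<bar> * ?\<phi> x)"
          using I_\<phi> I_R by simp
        show "set_integrable lborel ?I ?h"
          by (rule set_integrable_subset[OF h_int]) (use I_sub in auto)
        fix x assume x: "x \<in> ?I"
        then have *: "\<gamma> x \<in> Z" "0 \<le> R (x + c)" "R (x + c) \<le> \<psi> (\<gamma> x)" "\<psi> (\<gamma> x) \<le> 1"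
          using 3(3) \<psi>(2) I_sub by blast+
        \<comment> \<open>This bound by the first power links the \<open>L\<^sup>2\<close> norm to the \<open>L\<^sup>1\<close> norm of the NURBS constant.\<close>
        have "(1 - \<psi> (\<gamma> x))\<^sup>2 \<le> 1 - \<psi> (\<gamma> x)"
          using * by (simp add: power2_eq_square mult_left_le)
        then have "(1 - q) - \<bar>1 - R (x + c)\<bar> \<le> H (\<gamma> x)"
          using * by (simp add: H_def)
        then have "((1 - q) - \<bar>1 - R (x + c)\<bar>) * ?\<phi> x \<le> ?h x"
          by (intro mult_right_mono) (auto simp: speed_nonneg)
        then show "(1 - q) * ?\<phi> x - \<bar>1 - R (x + c)\<bar> * ?\<phi> x \<le> ?h x"
          by (simp add: algebra_simps)
      qed
      finally show ?thesis .
    qed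
  qed
  also have "(LINT x:{t 0..t (int N)}|lborel. ?h x) = (LINT x|\<mu>. H x)"
    using arclength_integral(1)[OF pc, of H cl] H_meas t by (simp add: \<mu>_def)
  finally show ?thesis
    using H_lint by simp
qed

text \<open>The NURBS constant is formulated for the basis function with index \<open>p + 1\<close>; here its hypotheses are
  transported to an arbitrary index.\<close>

lemma nurbs_constant_span:
  assumes q: "nurbs_constant (mesh_ratio \<gamma> (param_mesh n z)) wmin wmax p I \<phi> q"
    and t: "knot_sequence t" and w: "\<forall>i. 0 < w i"
    and I: "t ` {i - int p - 1..i + 2 * int p} \<subseteq> I"
    and W: "w ` {i - int p..i + int p} \<subseteq> {wmin..wmax}"
    and M: "knots_on_mesh \<gamma> n z t (i - int p - 1) (i + 2 * int p)"
    and s: "s \<in> {i..i + int p}"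
  shows "(LINT x:{t (s - 1)..t s}|lborel. \<bar>(1 - nurbs t w p i x) * \<phi> x\<bar>)
      \<le> (1 - q) * (LINT x:{t (s - 1)..t s}|lborel. \<bar>\<phi> x\<bar>)"
proof -
  let ?d = "i - int p - 1"
  let ?t = "\<lambda>k. t (k + ?d)" and ?w = "\<lambda>k. w (k + ?d)"
  have mono: "mono t"
    using t by (simp add: knot_sequence_def)
  have img: "(\<lambda>k. k + ?d) ` {0..3 * int p + 1} = {i - int p - 1..i + 2 * int p}"
    "(\<lambda>k. k + ?d) ` {1..2 * int p + 1} = {i - int p..i + int p}"
    by (auto simp: image_iff intro!: bexI[of _ "_ - ?d"])
  then have t_img: "?t ` {0..3 * int p + 1} = t ` {i - int p - 1..i + 2 * int p}"
    and w_img: "?w ` {1..2 * int p + 1} = w ` {i - int p..i + int p}"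
    by (metis image_image)+
  have "(LINT x:{?t (l - 1)..?t l}|lborel. \<bar>(1 - nurbs ?t ?w p (int p + 1) x) * \<phi> x\<bar>)
      \<le> (1 - q) * (LINT x:{?t (l - 1)..?t l}|lborel. \<bar>\<phi> x\<bar>)"
    if "l \<in> {int p + 1..2 * int p + 1}" for l
  proof (rule q[unfolded nurbs_constant_def, THEN conjunct2, THEN conjunct2, rule_format, OF _ that],
      intro conjI allI ballI)
    show "knot_sequence ?t"
      by (rule knot_sequence_shift[OF t])
    show "0 < w (k + ?d)" for k
      using w by blast
    show "?t ` {0..3 * int p + 1} \<subseteq> I" "?w ` {1..2 * int p + 1} \<subseteq> {wmin..wmax}"
      unfolding t_img w_img by (rule I, rule W)
    fix x y v
    assume xyv: "x \<in> ?t ` {0..3 * int p + 1}" "y \<in> ?t ` {0..3 * int p + 1}" "v \<in> ?t ` {0..3 * int p + 1}"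
    show "x < y \<and> y < v \<and> ?t ` {0..3 * int p + 1} \<inter> {x<..<v} = {y} \<longrightarrow>
        (v - y) / (y - x) \<le> mesh_ratio \<gamma> (param_mesh n z) \<and>
        (y - x) / (v - y) \<le> mesh_ratio \<gamma> (param_mesh n z)"
      using xyv unfolding t_img
      by (intro impI conjI; elim conjE) (rule knots_ratio[OF mono M]; assumption)+
  qed
  from this[of "s - ?d"] show ?thesis
    using s by (simp only: nurbs_shift) (simp add: algebra_simps)
qed

section \<open>Transformed NURBS\<close>

definition on_curve :: "bool \<Rightarrow> real \<Rightarrow> real \<Rightarrow> (real \<Rightarrow> real^2) \<Rightarrow> (real \<Rightarrow> real) \<Rightarrow> real^2 \<Rightarrow> real" where
  "on_curve cl a b \<gamma> g x =
     (if x \<in> \<gamma> ` param_domain cl a b then g (inv_into (param_domain cl a b) \<gamma> x) else 0)"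

lemma transformed_nurbs_eq: "transformed_nurbs cl a b \<gamma> t w p = on_curve cl a b \<gamma> ` nurbs_space t w p"
  unfolding transformed_nurbs_def on_curve_def[abs_def] param_domain_def Let_def ..

lemma boundary_part_bij:
  assumes "boundary_part cl \<Omega> \<Gamma> a b \<gamma>"
  shows "bij_betw \<gamma> (param_domain cl a b) (\<gamma> ` {a..b})"
  using assms by (auto simp: boundary_part_def param_domain_def)

lemma on_curve_param:
  assumes "inj_on \<gamma> (param_domain cl a b)" "x \<in> param_domain cl a b"
  shows "on_curve cl a b \<gamma> g (\<gamma> x) = g x"
  using assms by (simp add: on_curve_def)

lemma nurbs_part_mem_space: "nurbs_part t w p C \<in> nurbs_space t w p"
  by (auto simp: nurbs_space_def nurbs_part_def[abs_def])

lemma transformed_nurbs_subspace: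
  assumes "knot_sequence t"
  shows "module.subspace (\<lambda>c f x. c * f x) (transformed_nurbs cl a b \<gamma> t w p)"
proof -
  interpret module "\<lambda>c (f :: real^2 \<Rightarrow> real) x. c * f x"
    by unfold_locales (auto simp: fun_eq_iff algebra_simps)
  have mono: "mono t"
    using assms by (simp add: knot_sequence_def)
  show ?thesis
    unfolding subspace_def transformed_nurbs_eq
  proof (intro conjI ballI allI)
    have "(\<lambda>x. infsum (\<lambda>i. 0 * nurbs t w p i x) UNIV) \<in> nurbs_space t w p"
      unfolding nurbs_space_def by (intro CollectI exI[of _ "\<lambda>_. 0"]) simp
    then have "(\<lambda>x. 0) \<in> nurbs_space t w p"
      by simp
    then show "0 \<in> on_curve cl a b \<gamma> ` nurbs_space t w p"
      by (rule rev_image_eqI) (simp add: on_curve_def fun_eq_iff)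
  next
    fix f f' assume "f \<in> on_curve cl a b \<gamma> ` nurbs_space t w p" "f' \<in> on_curve cl a b \<gamma> ` nurbs_space t w p"
    then obtain c c' where f: "f = on_curve cl a b \<gamma> (\<lambda>x. infsum (\<lambda>i. c i * nurbs t w p i x) UNIV)"
      "f' = on_curve cl a b \<gamma> (\<lambda>x. infsum (\<lambda>i. c' i * nurbs t w p i x) UNIV)"
      unfolding nurbs_space_def by blast
    have "infsum (\<lambda>i. (c i + c' i) * nurbs t w p i x) UNIV =
       infsum (\<lambda>i. c i * nurbs t w p i x) UNIV + infsum (\<lambda>i. c' i * nurbs t w p i x) UNIV" for x
    proof -
      obtain s where s: "t (s - 1) \<le> x" "x < t s"
        using knot_span[OF assms] .
      show ?thesis
        unfolding combination_eq_span[OF mono s] by (simp only: distrib_right sum.distrib)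
    qed
    then have "f + f' = on_curve cl a b \<gamma> (\<lambda>x. infsum (\<lambda>i. (c i + c' i) * nurbs t w p i x) UNIV)"
      by (simp add: f on_curve_def fun_eq_iff)
    then show "f + f' \<in> on_curve cl a b \<gamma> ` nurbs_space t w p"
      by (intro image_eqI) (auto simp: nurbs_space_def)
  next
    fix d f assume "f \<in> on_curve cl a b \<gamma> ` nurbs_space t w p"
    then obtain c where f: "f = on_curve cl a b \<gamma> (\<lambda>x. infsum (\<lambda>i. c i * nurbs t w p i x) UNIV)"
      unfolding nurbs_space_def by blast
    have "infsum (\<lambda>i. (d * c i) * nurbs t w p i x) UNIV =
       d * infsum (\<lambda>i. c i * nurbs t w p i x) UNIV" for x
      by (simp add: mult.assoc infsum_cmult_right')
    then have "(\<lambda>x. d * f x) = on_curve cl a b \<gamma> (\<lambda>x. infsum (\<lambda>i. (d * c i) * nurbs t w p i x) UNIV)"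
      by (simp add: f on_curve_def fun_eq_iff)
    then show "(\<lambda>x. d * f x) \<in> on_curve cl a b \<gamma> ` nurbs_space t w p"
      by (intro image_eqI) (auto simp: nurbs_space_def)
  qed
qed

lemma on_curve_measurable:
  assumes "boundary_part cl \<Omega> \<Gamma> a b \<gamma>" "g \<in> borel_measurable borel"
  shows "on_curve cl a b \<gamma> g \<in> borel_measurable (arclength cl a b \<gamma>)"
proof -
  let ?D = "param_domain cl a b"
  have bij: "bij_betw \<gamma> ?D (\<gamma> ` {a..b})"
    by (rule boundary_part_bij[OF assms(1)])
  have "continuous_on {a..b} \<gamma>"
    using assms(1) by (simp add: boundary_part_def piecewise_C2_path_def)
  from inverse_parametrization_measurable[OF this bij]
  have "inv_into ?D \<gamma> \<in> borel_measurable (arclength cl a b \<gamma>)"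
    by (simp cong: measurable_cong_sets add: sets_arclength)
  then have "(\<lambda>x. g (inv_into ?D \<gamma> x)) \<in> borel_measurable (arclength cl a b \<gamma>)"
    using assms(2) by (rule measurable_compose)
  then show ?thesis
    by (rule measurable_cong[THEN iffD1, rotated])
      (use bij in \<open>auto simp: on_curve_def bij_betw_def\<close>)
qed

lemma transformed_nurbs_L2:
  assumes "boundary_part cl \<Omega> \<Gamma> a b \<gamma>" "knot_sequence t" "\<forall>i. 0 < w i"
  shows "transformed_nurbs cl a b \<gamma> t w p \<subseteq> L2_functions (arclength cl a b \<gamma>)"
proof
  let ?\<mu> = "arclength cl a b \<gamma>"
  have pc: "piecewise_C2_path a b \<gamma>"
    using assms(1) by (simp add: boundary_part_def)
  interpret finite_measure ?\<mu>
    by (rule finite_measure_arclength[OF pc])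
  fix f assume "f \<in> transformed_nurbs cl a b \<gamma> t w p"
  then obtain c where f: "f = on_curve cl a b \<gamma> (\<lambda>x. infsum (\<lambda>i. c i * nurbs t w p i x) UNIV)"
    by (auto simp: transformed_nurbs_eq nurbs_space_def)
  have meas: "f \<in> borel_measurable ?\<mu>"
    unfolding f by (rule on_curve_measurable[OF assms(1) borel_measurable_combination[OF assms(2)]])
  obtain M where M: "\<forall>x\<in>{a..b}. \<bar>infsum (\<lambda>k. c k * nurbs t w p k x) UNIV\<bar> \<le> M"
    using combination_bounded[OF assms(2,3)] by blast
  have "\<bar>f x\<bar> \<le> \<bar>M\<bar>" for x
  proof (cases "x \<in> \<gamma> ` param_domain cl a b")
    case True
    then have "inv_into (param_domain cl a b) \<gamma> x \<in> {a..b}"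
      using inv_into_into[OF True] by (auto simp: param_domain_def split: if_splits)
    then show ?thesis
      using M True by (force simp: f on_curve_def)
  qed (simp add: f on_curve_def)
  then have "(f x)\<^sup>2 \<le> M\<^sup>2" for x
    by (simp add: abs_le_square_iff)
  then have "integrable ?\<mu> (\<lambda>x. (f x)\<^sup>2)"
    using meas by (intro integrable_const_bound[of _ "M\<^sup>2"]) auto
  with meas show "f \<in> L2_functions ?\<mu>"
    by (simp add: L2_functions_def)
qed

text \<open>The inner points of the nondegenerate knot intervals are dense in \<open>[t\<^sub>i, t\<^sub>j]\<close>. The right end point is
  reached as a limit because it lies in no half-open knot interval inside \<open>[t\<^sub>i, t\<^sub>j)\<close>.\<close>

lemma supp_on_eq_image:
  fixes \<gamma> :: "real \<Rightarrow> real^2"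
  assumes "knot_sequence t" "t i < t j" "continuous_on {t i..t j} \<gamma>" "\<gamma> ` {t i..t j} \<subseteq> \<Gamma>"
    and nonzero: "\<And>s x. s \<in> {i<..j} \<Longrightarrow> x \<in> {t (s - 1)<..<t s} \<Longrightarrow> f (\<gamma> x) \<noteq> 0"
    and zero: "\<And>x. x \<in> \<Gamma> \<Longrightarrow> f x \<noteq> 0 \<Longrightarrow> x \<in> \<gamma> ` {t i..t j}"
  shows "supp_on \<Gamma> f = \<gamma> ` {t i..t j}"
proof
  have mono: "mono t"
    using assms(1) by (simp add: knot_sequence_def)
  have "compact (\<gamma> ` {t i..t j})"
    by (rule compact_continuous_image[OF assms(3)]) simp
  then show "supp_on \<Gamma> f \<subseteq> \<gamma> ` {t i..t j}"
    unfolding supp_on_def using zero by (intro closure_minimal) (auto intro: compact_imp_closed)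
  let ?S = "supp_on \<Gamma> f"
  have "\<gamma> y \<in> ?S" if y: "y \<in> {t i..<t j}" for y
  proof -
    obtain s where s: "t (s - 1) \<le> y" "y < t s"
      using knot_span[OF assms(1)] .
    have "t i < t s" "t (s - 1) < t j"
      using s y by auto
    then have "i < s" "s - 1 < j"
      by (auto intro: mono_index_less[OF mono])
    then have sub: "{t (s - 1)..t s} \<subseteq> {t i..t j}"
      using monoD[OF mono, of i "s - 1"] monoD[OF mono, of s j] by auto
    have closure: "closure {t (s - 1)<..<t s} = {t (s - 1)..t s}"
      using s by simp
    have "\<gamma> ` {t (s - 1)<..<t s} \<subseteq> {x\<in>\<Gamma>. f x \<noteq> 0}"
    proof (rule image_subsetI)
      fix x assume x: "x \<in> {t (s - 1)<..<t s}"
      then have "\<gamma> x \<in> \<Gamma>"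
        using sub assms(4) by force
      then show "\<gamma> x \<in> {x\<in>\<Gamma>. f x \<noteq> 0}"
        using nonzero[OF _ x] \<open>i < s\<close> \<open>s - 1 < j\<close> by simp
    qed
    then have "\<gamma> ` {t (s - 1)<..<t s} \<subseteq> ?S"
      unfolding supp_on_def using closure_subset by blast
    then have "\<gamma> ` closure {t (s - 1)<..<t s} \<subseteq> ?S"
      unfolding supp_on_def
      by (intro image_closure_subset closed_closure)
        (simp add: closure continuous_on_subset[OF assms(3) sub])
    then show ?thesis
      unfolding closure using s by auto
  qed
  then have "\<gamma> ` {t i..<t j} \<subseteq> ?S"
    by blast
  moreover have closure: "closure {t i..<t j} = {t i..t j}"
    using assms(2) by simp
  ultimately have "\<gamma> ` closure {t i..<t j} \<subseteq> ?S"
    unfolding supp_on_def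
    by (intro image_closure_subset closed_closure) (simp_all add: closure assms(3))
  then show "\<gamma> ` {t i..t j} \<subseteq> ?S"
    by (simp only: closure)
qed

section \<open>The functions attached to the elements\<close>

text \<open>All that the theorem requires of the function attached to one element. The function is chosen
  before \<open>q\<close>.\<close>

definition admissible_on_element ::
    "bool \<Rightarrow> real \<Rightarrow> real \<Rightarrow> (real \<Rightarrow> real^2) \<Rightarrow> nat \<Rightarrow> (nat \<Rightarrow> real) \<Rightarrow> nat \<Rightarrow> nat \<Rightarrow>
      (int \<Rightarrow> real) \<Rightarrow> (int \<Rightarrow> real) \<Rightarrow> nat \<Rightarrow> (real^2) set \<Rightarrow> (real^2 \<Rightarrow> real) \<Rightarrow> bool" where
  "admissible_on_element cl a b \<gamma> n z p N t w m T \<psi> \<longleftrightarrow>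
     \<psi> \<in> transformed_nurbs cl a b \<gamma> t w p \<and> connected (supp_on (\<gamma> ` {a..b}) \<psi>) \<and>
     T \<subseteq> supp_on (\<gamma> ` {a..b}) \<psi> \<and> supp_on (\<gamma> ` {a..b}) \<psi> \<subseteq> patch (mesh \<gamma> n z) m T \<and>
     (\<forall>q. nurbs_constant (mesh_ratio \<gamma> (param_mesh n z))
              (Min (given_weights cl p N w)) (Max (given_weights cl p N w)) p
              (nurbs_interval cl a b p m) (speed cl b \<gamma>) q \<longrightarrow>
        (LINT x:supp_on (\<gamma> ` {a..b}) \<psi>|arclength cl a b \<gamma>. (1 - \<psi> x)\<^sup>2)
          \<le> (1 - q) * measure (arclength cl a b \<gamma>) (supp_on (\<gamma> ` {a..b}) \<psi>))"

text \<open>The part of the argument shared by closed and open curves. The hypotheses \<open>param\<close> and \<open>zero\<close> identify the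
  function on the curve with the sum of NURBS on the line, and \<open>meets\<close> says that the image of
  \<open>[t\<^bsub>i-1\<^esub>, t\<^bsub>i+p\<^esub>]\<close> meets the image of the inside of a knot interval only if the latter is a translate
  of a knot interval inside \<open>[t\<^bsub>i-1\<^esub>, t\<^bsub>i+p\<^esub>]\<close>.\<close>

lemma admissible_nurbs_part:
  assumes B: "boundary_part cl \<Omega> \<Gamma> a b \<gamma>" and M: "is_mesh cl a b \<gamma> n z"
    and K: "mesh_knots cl a b n z p mlt N t" and w: "\<forall>k. 0 < w k"
    and m: "m \<le> p" "p \<le> 2 * m"
    and l: "t (l - 1) < t l" "\<gamma> ` {t (l - 1)..t l} \<in> mesh \<gamma> n z" and i: "i = l - int m" "i \<in> C"
    and kom: "knots_on_mesh \<gamma> n z t (i - 1) (i + int p)"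
    and param: "\<And>x. x \<in> {t (i - 1)..t (i + int p)} \<Longrightarrow>
      \<gamma> x \<in> \<gamma> ` {a..b} \<and> on_curve cl a b \<gamma> (nurbs_part t w p C) (\<gamma> x) = nurbs_part t w p C x"
    and zero: "\<And>x. x \<in> param_domain cl a b \<Longrightarrow> nurbs_part t w p C x \<noteq> 0 \<Longrightarrow>
      \<gamma> x \<in> \<gamma> ` {t (i - 1)..t (i + int p)}"
    and meets: "\<And>s x. s \<in> {1..int N} \<Longrightarrow> x \<in> {t (s - 1)<..<t s} \<Longrightarrow>
      \<gamma> x \<in> \<gamma> ` {t (i - 1)..t (i + int p)} \<Longrightarrow>
      \<exists>c. \<exists>s'\<in>{i..i + int p}. t s' = t s + c \<and> t (s' - 1) = t (s - 1) + c \<and>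
        (\<forall>x\<in>{t (s - 1)..t s}. \<gamma> (x + c) = \<gamma> x \<and> speed cl b \<gamma> (x + c) = speed cl b \<gamma> x)"
    and defect: "\<And>q s. nurbs_constant (mesh_ratio \<gamma> (param_mesh n z))
        (Min (given_weights cl p N w)) (Max (given_weights cl p N w)) p
        (nurbs_interval cl a b p m) (speed cl b \<gamma>) q \<Longrightarrow> s \<in> {i..i + int p} \<Longrightarrow>
      (LINT x:{t (s - 1)..t s}|lborel. \<bar>(1 - nurbs t w p i x) * speed cl b \<gamma> x\<bar>)
        \<le> (1 - q) * (LINT x:{t (s - 1)..t s}|lborel. \<bar>speed cl b \<gamma> x\<bar>)"
  shows "admissible_on_element cl a b \<gamma> n z p N t w m (\<gamma> ` {t (l - 1)..t l})
      (on_curve cl a b \<gamma> (nurbs_part t w p C))"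
proof -
  have t: "knot_sequence t" and mono: "mono t"
    using K by (auto simp: mesh_knots_def knot_sequence_def)
  have pc: "piecewise_C2_path a b \<gamma>" and ab: "a < b" and cont: "continuous_on {a..b} \<gamma>"
    using B by (auto simp: boundary_part_def piecewise_C2_path_def)
  note ends = mesh_knots_endpoints[OF M K ab]
  have z_mono: "strict_mono_on {0..n} z" and z: "z 0 = a" "z n = b"
    using M by (auto simp: is_mesh_def)
  have bij: "bij_betw \<gamma> (param_domain cl a b) (\<gamma> ` {a..b})"
    by (rule boundary_part_bij[OF B])
  let ?\<mu> = "arclength cl a b \<gamma>" and ?\<Gamma> = "\<gamma> ` {a..b}"
  let ?G = "nurbs_part t w p C" and ?R = "nurbs t w p i"
  let ?\<psi> = "on_curve cl a b \<gamma> ?G" and ?T = "\<gamma> ` {t (l - 1)..t l}"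
  let ?Z = "\<gamma> ` {t (i - 1)..t (i + int p)}"
  have nested: "t (i - 1) \<le> t (l - 1)" "t l \<le> t (i + int p)"
    using m i by (auto intro!: monoD[OF mono])
  have z_sub: "z ` {0..n} \<subseteq> {a..b}"
  proof (rule image_subsetI)
    fix j assume "j \<in> {0..n}"
    then show "z j \<in> {a..b}"
      using strict_mono_on_leD[OF z_mono, of j n] strict_mono_on_leD[OF z_mono, of 0 j] z by auto
  qed
  have cont_Z: "continuous_on {t (i - 1)..t (i + int p)} \<gamma>"
    by (rule knots_continuous[OF mono kom cont z_sub]) auto
  have Z_sub: "?Z \<subseteq> ?\<Gamma>"
    using param by blast
  have pos: "?\<psi> (\<gamma> x) \<noteq> 0" if s: "s \<in> {i - 1<..i + int p}" and x: "x \<in> {t (s - 1)<..<t s}" for s x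
  proof -
    have "t (i - 1) \<le> t (s - 1)" "t s \<le> t (i + int p)"
      using s by (auto intro!: monoD[OF mono])
    then have "?\<psi> (\<gamma> x) = ?G x"
      using param[of x] x by auto
    moreover have "0 < ?R x"
      using s x by (intro nurbs_pos[OF mono w, of s]) auto
    moreover have "?R x \<le> ?G x"
      by (rule nurbs_part_bounds(3)[OF t w i(2)])
    ultimately show ?thesis
      by simp
  qed
  have supp: "supp_on ?\<Gamma> ?\<psi> = ?Z"
  proof (rule supp_on_eq_image[OF t _ cont_Z Z_sub])
    show "?\<psi> (\<gamma> x) \<noteq> 0" if "s \<in> {i - 1<..i + int p}" "x \<in> {t (s - 1)<..<t s}" for s x
      using that by (rule pos)
    show "t (i - 1) < t (i + int p)"
      using nested l by simp
    fix x assume "x \<in> ?\<Gamma>" "?\<psi> x \<noteq> 0"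
    moreover from this obtain y where "y \<in> param_domain cl a b" "x = \<gamma> y"
      using bij by (auto simp: bij_betw_def)
    ultimately show "x \<in> ?Z"
      using zero on_curve_param[OF bij_betw_imp_inj_on[OF bij]] by metis
  qed
  have "connected ?Z"
    by (rule connected_continuous_image[OF cont_Z]) simp
  moreover have "?T \<subseteq> ?Z"
    using nested by (intro image_mono) auto
  moreover have "?Z \<subseteq> patch (mesh \<gamma> n z) m ?T"
  proof -
    have ends: "l - 1 - int m = i - 1" "l + int (p - m) = i + int p"
      using i m by auto
    have "\<gamma> ` {t (l - 1 - int m)..t l} \<subseteq> patch (mesh \<gamma> n z) m ?T"
      by (rule patch_knots(1)[OF mono kom l(2)]) (use i m in auto)
    \<comment> \<open>The right part needs only \<open>p - m \<le> m\<close> steps.\<close>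
    moreover have "\<gamma> ` {t (l - 1)..t (l + int (p - m))} \<subseteq> patch (mesh \<gamma> n z) (p - m) ?T"
      by (rule patch_knots(2)[OF mono kom l(2)]) (use i m in auto)
    moreover have "patch (mesh \<gamma> n z) (p - m) ?T \<subseteq> patch (mesh \<gamma> n z) m ?T"
      by (rule patch_mono[OF l(2)]) (use m in auto)
    moreover have "{t (i - 1)..t (i + int p)} \<subseteq> {t (i - 1)..t l} \<union> {t (l - 1)..t (i + int p)}"
      using l(1) by auto
    ultimately show ?thesis
      unfolding ends by blast
  qed
  moreover have "(LINT x:?Z|?\<mu>. (1 - ?\<psi> x)\<^sup>2) \<le> (1 - q) * measure ?\<mu> ?Z"
    if q: "nurbs_constant (mesh_ratio \<gamma> (param_mesh n z))
        (Min (given_weights cl p N w)) (Max (given_weights cl p N w)) p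
        (nurbs_interval cl a b p m) (speed cl b \<gamma>) q" for q
  proof (rule arclength_defect_le[OF pc mono ends(2,3)])
    have "?Z = ?\<Gamma> \<inter> ?Z"
      using Z_sub by blast
    moreover have "?Z \<in> sets borel"
      by (intro borel_compact compact_continuous_image cont_Z) simp
    ultimately show "?Z \<in> sets ?\<mu>"
      unfolding sets_arclength sets_restrict_space by (rule image_eqI)
    show "?\<psi> \<in> borel_measurable ?\<mu>"
      by (rule on_curve_measurable[OF B borel_measurable_nurbs_part[OF t]])
    show "\<forall>x\<in>?\<Gamma>. 0 \<le> ?\<psi> x \<and> ?\<psi> x \<le> 1"
      using nurbs_part_bounds(1,2)[OF t w] by (simp add: on_curve_def)
    fix s assume s: "s \<in> {1..int N}" "t (s - 1) < t s"
    show "(\<forall>x\<in>{t (s - 1)<..<t s}. \<gamma> x \<notin> ?Z) \<or>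
      (\<exists>c R. R \<in> borel_measurable borel \<and>
        (\<forall>x\<in>{t (s - 1)..t s}. \<gamma> x \<in> ?Z \<and> 0 \<le> R (x + c) \<and> R (x + c) \<le> ?\<psi> (\<gamma> x) \<and>
            speed cl b \<gamma> (x + c) = speed cl b \<gamma> x) \<and>
        (LINT x:{t (s - 1) + c..t s + c}|lborel. \<bar>(1 - R x) * speed cl b \<gamma> x\<bar>)
          \<le> (1 - q) * (LINT x:{t (s - 1) + c..t s + c}|lborel. \<bar>speed cl b \<gamma> x\<bar>))"
      (is "?away \<or> ?near")
    proof (cases ?away)
      case False
      then obtain x where "x \<in> {t (s - 1)<..<t s}" "\<gamma> x \<in> ?Z"
        by blast
      from meets[OF s(1) this]
      obtain c s' where s': "s' \<in> {i..i + int p}" "t s' = t s + c" "t (s' - 1) = t (s - 1) + c"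
        and c: "\<And>x. x \<in> {t (s - 1)..t s} \<Longrightarrow> \<gamma> (x + c) = \<gamma> x \<and> speed cl b \<gamma> (x + c) = speed cl b \<gamma> x"
        by blast
      have "t (i - 1) \<le> t (s' - 1)" "t s' \<le> t (i + int p)"
        using s'(1) by (auto intro!: monoD[OF mono])
      then have in_Z: "x + c \<in> {t (i - 1)..t (i + int p)}" if "x \<in> {t (s - 1)..t s}" for x
        using that s' by auto
      have "\<gamma> x \<in> ?Z \<and> 0 \<le> ?R (x + c) \<and> ?R (x + c) \<le> ?\<psi> (\<gamma> x) \<and>
            speed cl b \<gamma> (x + c) = speed cl b \<gamma> x" if x: "x \<in> {t (s - 1)..t s}" for x
      proof (intro conjI)
        show "\<gamma> x \<in> ?Z"
          using c[OF x] in_Z[OF x] by (metis imageI)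
        show "0 \<le> ?R (x + c)"
          by (rule nurbs_nonneg[OF mono w])
        have "?R (x + c) \<le> ?G (x + c)"
          by (rule nurbs_part_bounds(3)[OF t w i(2)])
        also have "\<dots> = ?\<psi> (\<gamma> x)"
          using param[OF in_Z[OF x]] c[OF x] by simp
        finally show "?R (x + c) \<le> ?\<psi> (\<gamma> x)" .
        show "speed cl b \<gamma> (x + c) = speed cl b \<gamma> x"
          using c[OF x] by simp
      qed
      moreover have "(LINT x:{t (s - 1) + c..t s + c}|lborel. \<bar>(1 - ?R x) * speed cl b \<gamma> x\<bar>)
          \<le> (1 - q) * (LINT x:{t (s - 1) + c..t s + c}|lborel. \<bar>speed cl b \<gamma> x\<bar>)"
        using defect[OF q s'(1)] by (simp only: s')
      ultimately have ?near
        using borel_measurable_nurbs[OF t, of w p i] by blast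
      then show ?thesis ..
    qed simp
  qed
  moreover have "?\<psi> \<in> transformed_nurbs cl a b \<gamma> t w p"
    unfolding transformed_nurbs_eq by (rule imageI) (rule nurbs_part_mem_space)
  ultimately show ?thesis
    unfolding admissible_on_element_def supp by blast
qed

text \<open>The interval of the NURBS constant is wide enough because \<open>N\<close> consecutive knot intervals make up a
  period: moving by \<open>r\<close> indices changes a knot by at most \<open>r\<close> periods.\<close>

lemma closed_admissible:
  assumes B: "boundary_part True \<Omega> \<Gamma> a b \<gamma>" and M: "is_mesh True a b \<gamma> n z"
    and K: "mesh_knots True a b n z p mlt N t" and W: "mesh_weights True N w"
    and m: "m \<le> p" "p \<le> 2 * m"
    and l: "l \<in> {1..int N}" "t (l - 1) < t l" "\<gamma> ` {t (l - 1)..t l} \<in> mesh \<gamma> n z"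
  shows "admissible_on_element True a b \<gamma> n z p N t w m (\<gamma> ` {t (l - 1)..t l})
      (on_curve True a b \<gamma> (nurbs_part t w p {k. int N dvd k - (l - int m)}))"
proof -
  define i where "i = l - int m"
  let ?C = "{k. int N dvd k - i}" and ?P = "b - a"
  have ab: "a < b" and \<gamma>_per: "\<forall>x. \<gamma> (x + ?P) = \<gamma> x"
    using B by (auto simp: boundary_part_def)
  have t: "knot_sequence t" and mono: "mono t" and t_per: "\<forall>k. t (k + int N) = t k + ?P"
    using K by (auto simp: mesh_knots_def knot_sequence_def)
  have w: "\<forall>k. 0 < w k" and w_per: "\<forall>k. w (k + int N) = w k"
    using W by (auto simp: mesh_weights_def add.commute)
  note ends = mesh_knots_endpoints[OF M K ab]
  have inj: "inj_on \<gamma> {a..<b}"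
    using boundary_part_bij[OF B] by (simp add: bij_betw_def param_domain_def)
  have G_per: "\<forall>x. nurbs_part t w p ?C (x + ?P) = nurbs_part t w p ?C x"
  proof (intro allI nurbs_part_periodic[OF t_per w_per])
    fix k
    have "int N dvd (k + int N) - i \<longleftrightarrow> int N dvd (k - i) + int N"
      by (simp add: algebra_simps)
    then show "k + int N \<in> ?C \<longleftrightarrow> k \<in> ?C"
      by simp
  qed
  have kom: "knots_on_mesh \<gamma> n z t lo hi" for lo hi
    by (rule knots_on_mesh_closed[OF M K ab \<gamma>_per])
  have shift: "t (k + e * int N) = t k + of_int e * ?P" for k e
    by (rule knots_periodic_int[OF t_per])
  show ?thesis
    unfolding i_def[symmetric]
  proof (rule admissible_nurbs_part[OF B M K w m l(2,3) i_def _ kom])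
    show "i \<in> ?C"
      by simp
    show "\<gamma> x \<in> \<gamma> ` {a..b} \<and>
        on_curve True a b \<gamma> (nurbs_part t w p ?C) (\<gamma> x) = nurbs_part t w p ?C x" for x
    proof -
      obtain y k where y: "y \<in> {a..<b}" "x = y + of_int k * ?P"
        using periodic_representative[OF ab] .
      then have "\<gamma> x = \<gamma> y" "nurbs_part t w p ?C x = nurbs_part t w p ?C y"
        using periodic_int[OF \<gamma>_per, of y k] periodic_int[OF G_per, of y k] by auto
      moreover have "on_curve True a b \<gamma> (nurbs_part t w p ?C) (\<gamma> y) = nurbs_part t w p ?C y"
        using y inj by (intro on_curve_param) (auto simp: param_domain_def)
      ultimately show ?thesis
        using y by auto
    qed
    show "\<gamma> x \<in> \<gamma> ` {t (i - 1)..t (i + int p)}" if "nurbs_part t w p ?C x \<noteq> 0" for x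
    proof -
      obtain k where "k \<in> ?C" "nurbs t w p k x \<noteq> 0"
        using nurbs_part_bounds(4)[OF t w \<open>nurbs_part t w p ?C x \<noteq> 0\<close>] by blast
      then obtain e where "k - i = int N * e"
        by (auto elim: dvdE)
      then have e: "k = i + e * int N"
        by (simp add: algebra_simps)
      have x: "x \<in> {t (k - 1)..<t (k + int p)}"
        using nurbs_eq_0[OF mono, of x k p w] \<open>nurbs t w p k x \<noteq> 0\<close> by blast
      have "t (k - 1) = t (i - 1) + of_int e * ?P" "t (k + int p) = t (i + int p) + of_int e * ?P"
        using shift[of "i - 1" e] shift[of "i + int p" e] by (simp_all add: e algebra_simps)
      then have "x - of_int e * ?P \<in> {t (i - 1)..t (i + int p)}"
        using x by auto
      moreover have "\<gamma> (x - of_int e * ?P) = \<gamma> x"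
        using periodic_int[OF \<gamma>_per, of "x - of_int e * ?P" e] by simp
      ultimately show ?thesis
        by (metis imageI)
    qed
    fix s x
    assume s: "s \<in> {1..int N}" and x: "x \<in> {t (s - 1)<..<t s}"
      and "\<gamma> x \<in> \<gamma> ` {t (i - 1)..t (i + int p)}"
    then obtain y where y: "y \<in> {t (i - 1)..t (i + int p)}" "\<gamma> x = \<gamma> y"
      by blast
    obtain y0 e where y0: "y0 \<in> {a..<b}" "y = y0 + of_int e * ?P"
      using periodic_representative[OF ab] .
    have "a \<le> t (s - 1)" "t s \<le> b"
      unfolding ends(2,3)[symmetric] using s by (auto intro!: monoD[OF mono])
    then have "x \<in> {a..<b}"
      using x by auto
    moreover have "\<gamma> x = \<gamma> y0"
      using y(2) y0(2) periodic_int[OF \<gamma>_per, of y0 e] by simp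
    ultimately have "y = x + of_int e * ?P"
      using inj y0 by (auto dest: inj_onD)
    \<comment> \<open>The parameter \<open>y\<close> lies \<open>e\<close> periods away from \<open>x\<close>, in the knot interval with index \<open>s + e N\<close>.\<close>
    let ?s' = "s + e * int N" and ?c = "of_int e * ?P"
    have s': "t ?s' = t s + ?c" "t (?s' - 1) = t (s - 1) + ?c"
      using shift[of s e] shift[of "s - 1" e] by (simp_all add: algebra_simps)
    then have "t (i - 1) < t ?s'" "t (?s' - 1) < t (i + int p)"
      using x y(1) \<open>y = x + of_int e * ?P\<close> by auto
    then have "?s' \<in> {i..i + int p}"
      by (auto dest!: mono_index_less[OF mono])
    moreover have "\<forall>x. \<gamma> (x + ?c) = \<gamma> x"
      by (intro allI periodic_int[OF \<gamma>_per])
    ultimately show "\<exists>c. \<exists>s'\<in>{i..i + int p}. t s' = t s + c \<and> t (s' - 1) = t (s - 1) + c \<and>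
        (\<forall>x\<in>{t (s - 1)..t s}. \<gamma> (x + c) = \<gamma> x \<and> speed True b \<gamma> (x + c) = speed True b \<gamma> x)"
      using s' by (intro exI[of _ ?c] bexI[of _ ?s']) (simp_all add: speed_periodic)
  next
    fix q s
    assume q: "nurbs_constant (mesh_ratio \<gamma> (param_mesh n z))
        (Min (given_weights True p N w)) (Max (given_weights True p N w)) p
        (nurbs_interval True a b p m) (speed True b \<gamma>) q" and s: "s \<in> {i..i + int p}"
    show "(LINT x:{t (s - 1)..t s}|lborel. \<bar>(1 - nurbs t w p i x) * speed True b \<gamma> x\<bar>)
        \<le> (1 - q) * (LINT x:{t (s - 1)..t s}|lborel. \<bar>speed True b \<gamma> x\<bar>)"
    proof (rule nurbs_constant_span[OF q t w _ _ kom s])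
      have bounds: "a \<le> t (l - 1)" "t l \<le> b"
        unfolding ends(2,3)[symmetric] using l(1) by (auto intro!: monoD[OF mono])
      have N: "int r \<le> int r * int N" for r
        using mult_left_mono[of 1 "int N" "int r"] ends(1) by simp
      have "t (l - 1) - real (m + p) * ?P \<le> t (i - int p - 1)"
      proof -
        have "l - 1 + (- int (m + p)) * int N \<le> i - int p - 1"
          using N[of "m + p"] by (simp add: i_def algebra_simps)
        from monoD[OF mono this] show ?thesis
          unfolding shift by (simp add: algebra_simps)
      qed
      moreover have "t (i + 2 * int p) \<le> t l + real (2 * p - m) * ?P"
      proof -
        have "i + 2 * int p \<le> l + int (2 * p - m) * int N"
          using N[of "2 * p - m"] m by (simp add: i_def of_nat_diff algebra_simps)
        from monoD[OF mono this] show ?thesis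
          unfolding shift by simp
      qed
      moreover have "real (2 * p - m) = 2 * real p - real m"
        using m by (simp add: of_nat_diff)
      ultimately have "a - ?P * (real m + real p) \<le> t (i - int p - 1)"
        "t (i + 2 * int p) \<le> b + ?P * (2 * real p - real m)"
        using bounds by (simp_all add: mult.commute)
      moreover have "t (i - int p - 1) \<le> t k" "t k \<le> t (i + 2 * int p)"
        if "k \<in> {i - int p - 1..i + 2 * int p}" for k
        using that by (auto intro!: monoD[OF mono])
      ultimately show "t ` {i - int p - 1..i + 2 * int p} \<subseteq> nurbs_interval True a b p m"
        by (fastforce simp: nurbs_interval_def)
      show "w ` {i - int p..i + int p} \<subseteq> {Min (given_weights True p N w)..Max (given_weights True p N w)}"
      proof (rule image_subsetI)
        fix k
        obtain k' e where k': "k' \<in> {1..int N}" "k = k' + e * int N"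
          using index_mod[OF ends(1)] .
        have "w k = w k'"
          using knots_periodic_int[of w "int N" 0 k' e] w_per k'(2) by simp
        then have "w k \<in> given_weights True p N w"
          using k'(1) by (simp add: given_weights_def)
        moreover have "finite (given_weights True p N w)"
          by (simp add: given_weights_def)
        ultimately show "w k \<in> {Min (given_weights True p N w)..Max (given_weights True p N w)}"
          by simp
      qed
    qed
  qed
qed

text \<open>On \<open>[a, b)\<close> the active B-splines have indices \<open>1, \<dots>, N - p\<close> and involve only \<open>t\<^sub>0, \<dots>, t\<^sub>N\<close>. At \<open>b\<close>
  other B-splines become active, but both sides vanish there, as supports are half-open.\<close>

lemma nurbs_clamped:
  fixes w :: "int \<Rightarrow> real"
  assumes M: "is_mesh False a b \<gamma> n z" and K: "mesh_knots False a b n z p mlt N t" and ab: "a < b"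
    and i: "1 \<le> i" "i + int p \<le> int N" and x: "x \<in> {a..b}"
    and w': "\<And>k. k \<in> {1..int N - int p} \<Longrightarrow> w' k = w k"
  shows "nurbs (clamped_knots p N t) w' p i x = nurbs t w p i x"
proof -
  let ?t = "clamped_knots p N t"
  have t: "knot_sequence t" and mono: "mono t"
    using K by (auto simp: mesh_knots_def knot_sequence_def)
  note ends = mesh_knots_endpoints[OF M K ab]
  note mult = open_knot_multiplicities[OF M K ab]
  have t': "mono ?t"
    using knot_sequence_clamped[OF mono] by (simp add: knot_sequence_def)
  have eq: "?t k = t k" if "0 \<le> k" "k \<le> int N" for k
    by (rule clamped_knots_eq(1)[OF that])
  show ?thesis
  proof (cases "x < b")
    case True
    obtain s where s: "t (s - 1) \<le> x" "x < t s"
      using knot_span[OF t] .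
    have "t (int p) < t s" "t (s - 1) < t (int N - int p)"
      unfolding mult using s True x by auto
    then have "int p < s" "s - 1 < int N - int p"
      by (auto intro: mono_index_less[OF mono])
    then show ?thesis
      using eq w' by (intro nurbs_cong[OF mono t' s, symmetric]) auto
  next
    case False
    have "t (i + int p) \<le> b"
      unfolding ends(3)[symmetric] using i by (intro monoD[OF mono])
    then show ?thesis
      using False eq[of "i + int p"] i
      by (simp add: nurbs_eq_0[OF mono] nurbs_eq_0[OF t'])
  qed
qed

text \<open>The multiplicity \<open>p + 1\<close> of both end points forces \<open>p < l \<le> N - p\<close>, so that the support of \<open>R\<^sub>i\<close> is
  spanned by knots in \<open>[a, b]\<close>.\<close>

lemma open_admissible:
  assumes B: "boundary_part False \<Omega> \<Gamma> a b \<gamma>" and M: "is_mesh False a b \<gamma> n z"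
    and K: "mesh_knots False a b n z p mlt N t" and W: "mesh_weights False N w"
    and m: "m \<le> p" "p \<le> 2 * m"
    and l: "l \<in> {1..int N}" "t (l - 1) < t l" "\<gamma> ` {t (l - 1)..t l} \<in> mesh \<gamma> n z"
  shows "admissible_on_element False a b \<gamma> n z p N t w m (\<gamma> ` {t (l - 1)..t l})
      (on_curve False a b \<gamma> (nurbs_part t w p {l - int m}))"
proof -
  define i where "i = l - int m"
  have ab: "a < b"
    using B by (auto simp: boundary_part_def)
  have t: "knot_sequence t" and mono: "mono t"
    using K by (auto simp: mesh_knots_def knot_sequence_def)
  have w: "\<forall>k. 0 < w k"
    using W by (auto simp: mesh_weights_def)
  note ends = mesh_knots_endpoints[OF M K ab]
  note mult = open_knot_multiplicities[OF M K ab]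
  have inj: "inj_on \<gamma> {a..b}"
    using boundary_part_bij[OF B] by (simp add: bij_betw_def param_domain_def)
  have in_ab: "t k \<in> {a..b}" if "0 \<le> k" "k \<le> int N" for k
    unfolding ends(2,3)[symmetric] using that by (auto intro!: monoD[OF mono])
  have "t (int p) < t l" "t (l - 1) < t (int N - int p)"
    unfolding mult using l in_ab[of "l - 1"] in_ab[of l] by auto
  then have "int p < l" "l - 1 < int N - int p"
    by (auto intro: mono_index_less[OF mono])
  then have i: "1 \<le> i" "i + int p \<le> int N" "1 \<le> int N - int p"
    using m by (auto simp: i_def)
  have span_sub: "{t (i - 1)..t (i + int p)} \<subseteq> {a..b}"
    using in_ab[of "i - 1"] in_ab[of "i + int p"] i by auto
  show ?thesis
    unfolding i_def[symmetric]
  proof (rule admissible_nurbs_part[OF B M K w m l(2,3) i_def])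
    show "knots_on_mesh \<gamma> n z t (i - 1) (i + int p)"
      by (rule knots_on_mesh_mono[OF knots_on_mesh_given[OF M K ab]]) (use i in auto)
    show "i \<in> {i}"
      by simp
    show "\<gamma> x \<in> \<gamma> ` {a..b} \<and>
        on_curve False a b \<gamma> (nurbs_part t w p {i}) (\<gamma> x) = nurbs_part t w p {i} x"
      if "x \<in> {t (i - 1)..t (i + int p)}" for x
    proof -
      have x: "x \<in> {a..b}"
        using that span_sub by blast
      then show ?thesis
        using inj on_curve_param[of \<gamma> False a b x] by (auto simp: param_domain_def)
    qed
    show "\<gamma> x \<in> \<gamma> ` {t (i - 1)..t (i + int p)}" if nz: "nurbs_part t w p {i} x \<noteq> 0" for x
    proof -
      have "nurbs t w p i x \<noteq> 0"
        using nz by (simp add: nurbs_part_singleton[OF t])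
      then have "x \<in> {t (i - 1)..<t (i + int p)}"
        using nurbs_eq_0[OF mono, of x i p w] by blast
      then show ?thesis
        by auto
    qed
    fix s x
    assume s: "s \<in> {1..int N}" and x: "x \<in> {t (s - 1)<..<t s}"
      and "\<gamma> x \<in> \<gamma> ` {t (i - 1)..t (i + int p)}"
    then obtain y where y: "y \<in> {t (i - 1)..t (i + int p)}" "\<gamma> x = \<gamma> y"
      by blast
    have "x \<in> {a..b}"
      using x in_ab[of "s - 1"] in_ab[of s] s by auto
    then have "x = y"
      using inj y span_sub by (auto dest: inj_onD)
    then have "t (i - 1) < t s" "t (s - 1) < t (i + int p)"
      using x y by auto
    then have "s \<in> {i..i + int p}"
      by (auto dest!: mono_index_less[OF mono])
    then show "\<exists>c. \<exists>s'\<in>{i..i + int p}. t s' = t s + c \<and> t (s' - 1) = t (s - 1) + c \<and>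
        (\<forall>x\<in>{t (s - 1)..t s}. \<gamma> (x + c) = \<gamma> x \<and> speed False b \<gamma> (x + c) = speed False b \<gamma> x)"
      by (intro exI[of _ 0] bexI[of _ s]) auto
  next
    fix q s
    assume q: "nurbs_constant (mesh_ratio \<gamma> (param_mesh n z))
        (Min (given_weights False p N w)) (Max (given_weights False p N w)) p
        (nurbs_interval False a b p m) (speed False b \<gamma>) q" and s: "s \<in> {i..i + int p}"
    let ?t = "clamped_knots p N t"
    \<comment> \<open>The weight \<open>w\<^sub>1\<close> is a given one because \<open>1 \<le> N - p\<close>.\<close>
    define w' where "w' k = (if k \<in> {1..int N - int p} then w k else w 1)" for k
    have eq: "?t (s - 1) = t (s - 1)" "?t s = t s"
      using s i by (auto simp: clamped_knots_eq)
    have R: "nurbs ?t w' p i x = nurbs t w p i x" if "x \<in> {t (s - 1)..t s}" for x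
    proof (rule nurbs_clamped[OF M K ab i(1,2)])
      show "x \<in> {a..b}"
        using that in_ab[of "s - 1"] in_ab[of s] s i by auto
    qed (simp add: w'_def)
    have "(LINT x:{?t (s - 1)..?t s}|lborel. \<bar>(1 - nurbs ?t w' p i x) * speed False b \<gamma> x\<bar>)
        \<le> (1 - q) * (LINT x:{?t (s - 1)..?t s}|lborel. \<bar>speed False b \<gamma> x\<bar>)"
    proof (rule nurbs_constant_span[OF q knot_sequence_clamped[OF mono] _ _ _ _ s])
      show "\<forall>k. 0 < w' k"
        using w by (simp add: w'_def)
      show "knots_on_mesh \<gamma> n z ?t (i - int p - 1) (i + 2 * int p)"
        by (rule knots_on_mesh_mono[OF knots_on_mesh_clamped[OF M K ab]]) (use i in auto)
      show "?t ` {i - int p - 1..i + 2 * int p} \<subseteq> nurbs_interval False a b p m"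
      proof (rule image_subsetI)
        fix k assume "k \<in> {i - int p - 1..i + 2 * int p}"
        then show "?t k \<in> nurbs_interval False a b p m"
          using clamped_knots_range[OF mono, of p k N] i by (simp add: nurbs_interval_def ends)
      qed
      have "finite (given_weights False p N w)"
        by (simp add: given_weights_def)
      moreover have "w' k \<in> given_weights False p N w" for k
        using i(3) by (auto simp: w'_def given_weights_def)
      ultimately show "w' ` {i - int p..i + int p} \<subseteq>
          {Min (given_weights False p N w)..Max (given_weights False p N w)}"
        by auto
    qed
    also have "(LINT x:{?t (s - 1)..?t s}|lborel. \<bar>(1 - nurbs ?t w' p i x) * speed False b \<gamma> x\<bar>)
        = (LINT x:{t (s - 1)..t s}|lborel. \<bar>(1 - nurbs t w p i x) * speed False b \<gamma> x\<bar>)"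
      unfolding eq by (rule set_lebesgue_integral_cong) (use R in auto)
    finally show "(LINT x:{t (s - 1)..t s}|lborel. \<bar>(1 - nurbs t w p i x) * speed False b \<gamma> x\<bar>)
        \<le> (1 - q) * (LINT x:{t (s - 1)..t s}|lborel. \<bar>speed False b \<gamma> x\<bar>)"
      unfolding eq .
  qed
qed

theorem theorem4p4:
  fixes \<Omega> \<Gamma> :: "(real^2) set" and \<gamma> :: "real \<Rightarrow> real^2" and a b :: real and cl :: bool
    and n N p m :: nat and z :: "nat \<Rightarrow> real" and mlt :: "real \<Rightarrow> nat" and t w :: "int \<Rightarrow> real"
    and \<mu> :: "(real^2) measure" and X :: "(real^2 \<Rightarrow> real) set"
  assumes "boundary_part cl \<Omega> \<Gamma> a b \<gamma>"
    and "is_mesh cl a b \<gamma> n z"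
    and "mesh_knots cl a b n z p mlt N t"
    and "mesh_weights cl N w"
    and "m = nat \<lceil>real p / 2\<rceil>"
    and "\<mu> = arclength cl a b \<gamma>"
    and "X = transformed_nurbs cl a b \<gamma> t w p"
  shows "module.subspace (\<lambda>c f x. c * f x) X \<and> X \<subseteq> L2_functions \<mu> \<and>
    (\<exists>\<psi> :: (real^2) set \<Rightarrow> real^2 \<Rightarrow> real.
      (\<forall>T\<in>mesh \<gamma> n z. \<psi> T \<in> X \<and> connected (supp_on \<Gamma> (\<psi> T)) \<and>
          T \<subseteq> supp_on \<Gamma> (\<psi> T) \<and> supp_on \<Gamma> (\<psi> T) \<subseteq> patch (mesh \<gamma> n z) m T) \<and>
      (\<forall>q. nurbs_constant (mesh_ratio \<gamma> (param_mesh n z))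
              (Min (given_weights cl p N w)) (Max (given_weights cl p N w)) p
              (nurbs_interval cl a b p m) (speed cl b \<gamma>) q \<longrightarrow>
          (\<forall>T\<in>mesh \<gamma> n z.
            (LINT x:supp_on \<Gamma> (\<psi> T)|\<mu>. (1 - \<psi> T x)\<^sup>2)
              \<le> (1 - q) * measure \<mu> (supp_on \<Gamma> (\<psi> T)))))"
proof -
  note B = assms(1) and M = assms(2) and K = assms(3) and W = assms(4)
  have t: "knot_sequence t" and w: "\<forall>k. 0 < w k"
    using K W by (auto simp: mesh_knots_def mesh_weights_def)
  have ab: "a < b" and \<Gamma>: "\<gamma> ` {a..b} = \<Gamma>"
    using B by (auto simp: boundary_part_def)
  have m: "m \<le> p" "p \<le> 2 * m"
    unfolding assms(5) by linarith+
  have "\<exists>\<psi>. admissible_on_element cl a b \<gamma> n z p N t w m T \<psi>" if elem: "T \<in> mesh \<gamma> n z" for T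
  proof -
    obtain j where j: "j \<in> {1..n}" "T = \<gamma> ` {z (j - 1)..z j}"
      using elem unfolding mesh_def param_mesh_def by blast
    obtain l where l: "l \<in> {1..int N}" "t (l - 1) = z (j - 1)" "t l = z j"
      using element_knot_span[OF M K ab j(1)] by blast
    have "z (j - 1) < z j"
    proof (rule strict_mono_onD[of "{0..n}" z])
      show "strict_mono_on {0..n} z"
        using M by (simp add: is_mesh_def)
    qed (use j(1) in auto)
    then have l': "t (l - 1) < t l" and T: "T = \<gamma> ` {t (l - 1)..t l}"
      using l j by auto
    show ?thesis
    proof (cases cl)
      case True
      then have cl: "cl = True"
        by simp
      show ?thesis
        unfolding T cl
        by (rule exI, rule closed_admissible[OF B[unfolded cl] M[unfolded cl] K[unfolded cl]
              W[unfolded cl] m l(1) l' elem[unfolded T]])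
    next
      case False
      then have cl: "cl = False"
        by simp
      show ?thesis
        unfolding T cl
        by (rule exI, rule open_admissible[OF B[unfolded cl] M[unfolded cl] K[unfolded cl]
              W[unfolded cl] m l(1) l' elem[unfolded T]])
    qed
  qed
  then have "\<forall>T\<in>mesh \<gamma> n z. \<exists>\<psi>. admissible_on_element cl a b \<gamma> n z p N t w m T \<psi>"
    by blast
  from bchoice[OF this] obtain \<psi>
    where \<psi>: "\<forall>T\<in>mesh \<gamma> n z. admissible_on_element cl a b \<gamma> n z p N t w m T (\<psi> T)"
    by blast
  note \<psi>_props = \<psi>[unfolded admissible_on_element_def \<Gamma>, folded assms(6,7), rule_format]
  show ?thesis
  proof (intro conjI exI[of _ \<psi>] ballI allI impI)
    show "module.subspace (\<lambda>c f x. c * f x) X" "X \<subseteq> L2_functions \<mu>"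
      using transformed_nurbs_subspace[OF t] transformed_nurbs_L2[OF B t w]
      unfolding assms(6,7) by simp_all
  qed (use \<psi>_props in simp_all)
qed

end
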